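(* Let $\alpha,\beta,k>0$, $T_{\mathrm m}\in\mathbb R$. Consider the one-phase Stefan problem (plant) $$T_t(x,t)=\alpha T_{xx}(x,t)\ (0\le x\le s(t)),\quad -kT_x(0,t)=q_{\mathrm c}(t),\quad T(s(t),t)=T_{\mathrm m},\quad \dot s(t)=-\beta T_x(s(t),t),$$ with $T(x,0)=T_0(x)$, $s(0)=s_0>0$, where for some constant $H$ one has $0\le T_0(x)-T_{\mathrm m}\le H(s_0-x)$ on $[0,s_0]$, with measurement $Y(t)=s(t)$, and the observer, for $x\in[0,s(t)]$, $$\hat T_t(x,t)=\alpha\hat T_{xx}(x,t)-p_1(x,s(t))\left(\frac{\dot Y(t)}{\beta}+\hat T_x(s(t),t)\right),\quad -k\hat T_x(0,t)=q_{\mathrm c}(t),\quad \hat T(s(t),t)=T_{\mathrm m},$$ with observer gain $$p_1(x,s(t))=-\lambda s(t)\,\frac{I_1\!\left(\sqrt{\frac{\lambda}{\alpha}(s(t)^2-x^2)}\right)}{\sqrt{\frac{\lambda}{\alpha}(s(t)^2-x^2)}}$$ and gain parameter $\lambda>0$. Let $s_{\mathrm r}$ be the setpoint and assume that $$q_{\mathrm c}(t)>0\quad\text{and}\quad s(t)<s_{\mathrm r}\qquad\text{for all }t>0 .$$ Then, for all $\lambda>0$, the observer error system is exponentially stable in the sense of the norm $\|T-\hat T\|_{\mathcal H_1}^2$.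
   Context: $I_1$ is the modified Bessel function of the first kind of order 1; the quotient $I_1(z)/z$ is extended continuously by $1/2$ at $z=0$. $(T,s)$ and $\hat T$ denote (classical) solutions for $t\ge0$ with $s(t)>0$; $\hat T$ has an initial condition $\hat T(x,0)=\hat T_0(x)$ on $[0,s_0]$. The observer error is $\tilde T=T-\hat T$. Norms at time $t$: $\|u\|_{\mathcal L_2}^2=\int_0^{s(t)}u(x,t)^2dx$ and $\|u\|_{\mathcal H_1}^2=\|u\|_{\mathcal L_2}^2+\|u_x\|_{\mathcal L_2}^2$. "Exponentially stable in the sense of the norm $\Phi(t)$" means: there exist constants $D,b>0$, depending only on the system parameters, the gain parameter and the setpoint (not on the particular solution), such that $\Phi(t)\le D\,\Phi(0)e^{-bt}$ for all $t\ge0$. *)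

theory Defs
  imports "HOL-Analysis.Analysis"
begin

definition bessel_I1 :: "real \<Rightarrow> real" where
  "bessel_I1 z = (\<Sum>m. (z / 2) ^ (2 * m + 1) / (fact m * fact (m + 1)))"

definition bessel_I1_quot :: "real \<Rightarrow> real" where
  "bessel_I1_quot z = (if z = 0 then 1 / 2 else bessel_I1 z / z)"

definition observer_gain :: "real \<Rightarrow> real \<Rightarrow> real \<Rightarrow> real \<Rightarrow> real" where
  "observer_gain \<alpha> lam x \<sigma> =
     - lam * \<sigma> * bessel_I1_quot (sqrt (lam / \<alpha> * (\<sigma>\<^sup>2 - x\<^sup>2)))"

text \<open>A profile \<open>u x t\<close> lives on \<open>0 \<le> x \<le> s t\<close>; its values elsewhere are irrelevant, so
  the derivative in \<open>x\<close> is taken within that interval (hence one-sided at the end points).\<close>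

definition x_deriv ::
  "(real \<Rightarrow> real) \<Rightarrow> (real \<Rightarrow> real \<Rightarrow> real) \<Rightarrow> real \<Rightarrow> real \<Rightarrow> real" where
  "x_deriv s u x t = vector_derivative (\<lambda>y. u y t) (at x within {0..s t})"

text \<open>The times at which the point \<open>x \<ge> 0\<close> lies in the domain; time derivatives are taken
  within this set. For \<open>t > 0\<close> and \<open>x < s t\<close> it is a neighbourhood of \<open>t\<close> when \<open>s\<close> is continuous.\<close>

definition active_times :: "(real \<Rightarrow> real) \<Rightarrow> real \<Rightarrow> real set" where
  "active_times s x = {\<tau>. 0 \<le> \<tau> \<and> x \<le> s \<tau>}"

definition space_time :: "(real \<Rightarrow> real) \<Rightarrow> (real \<times> real) set" where
  "space_time s = {(x, t). 0 \<le> t \<and> 0 \<le> x \<and> x \<le> s t}"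

text \<open>Regularity in the space variable of a classical solution. Continuity of the time derivative
  for \<open>t > 0\<close> is not listed since it follows from the differential equation. The finite set \<open>N\<close>
  admits piecewise continuously differentiable initial profiles that need not match the
  flux condition at \<open>x = 0\<close>.\<close>

definition classical_profile :: "(real \<Rightarrow> real) \<Rightarrow> (real \<Rightarrow> real \<Rightarrow> real) \<Rightarrow> bool" where
  "classical_profile s u \<longleftrightarrow>
     continuous_on (space_time s) (\<lambda>(x, t). u x t) \<and>
     (\<forall>t>0. \<forall>x\<in>{0..s t}.
        (\<lambda>y. u y t) differentiable (at x within {0..s t}) \<and>
        (\<lambda>y. x_deriv s u y t) differentiable (at x within {0..s t})) \<and>
     continuous_on (space_time s \<inter> {(x, t). 0 < t}) (\<lambda>(x, t). x_deriv s (x_deriv s u) x t) \<and>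
     (\<exists>N. finite N \<and>
        (\<forall>x\<in>{0..s 0} - N. (\<lambda>y. u y 0) differentiable (at x within {0..s 0})) \<and>
        continuous_on (space_time s - N \<times> {0}) (\<lambda>(x, t). x_deriv s u x t)) \<and>
     (\<exists>M. \<exists>\<delta>>0. \<forall>t\<in>{0<..\<delta>}. \<forall>x\<in>{0..s t}. \<bar>x_deriv s u x t\<bar> \<le> M)"

definition stefan_plant ::
  "real \<Rightarrow> real \<Rightarrow> real \<Rightarrow> real \<Rightarrow> (real \<Rightarrow> real) \<Rightarrow> (real \<Rightarrow> real) \<Rightarrow> real \<Rightarrow>
   (real \<Rightarrow> real \<Rightarrow> real) \<Rightarrow> (real \<Rightarrow> real) \<Rightarrow> bool" where
  "stefan_plant \<alpha> \<beta> k Tm qc T0 s0 T s \<longleftrightarrow>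
     continuous_on {0..} s \<and> (\<forall>t\<ge>0. s t > 0) \<and> classical_profile s T \<and>
     (\<forall>t>0. \<forall>x\<in>{0..s t}.
        ((\<lambda>\<tau>. T x \<tau>) has_real_derivative \<alpha> * x_deriv s (x_deriv s T) x t)
          (at t within active_times s x)) \<and>
     (\<forall>t>0. - k * x_deriv s T 0 t = qc t) \<and>
     (\<forall>t>0. T (s t) t = Tm) \<and>
     (\<forall>t>0. (s has_real_derivative - \<beta> * x_deriv s T (s t) t) (at t)) \<and>
     (\<forall>x\<in>{0..s0}. T x 0 = T0 x) \<and> s 0 = s0"

definition stefan_observer ::
  "real \<Rightarrow> real \<Rightarrow> real \<Rightarrow> real \<Rightarrow> real \<Rightarrow> (real \<Rightarrow> real) \<Rightarrow> (real \<Rightarrow> real) \<Rightarrow> (real \<Rightarrow> real) \<Rightarrow>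
   (real \<Rightarrow> real) \<Rightarrow> (real \<Rightarrow> real \<Rightarrow> real) \<Rightarrow> bool" where
  "stefan_observer \<alpha> \<beta> k Tm lam qc Y s Th0 Th \<longleftrightarrow>
     classical_profile s Th \<and>
     (\<forall>t>0. \<forall>x\<in>{0..s t}.
        ((\<lambda>\<tau>. Th x \<tau>) has_real_derivative
           \<alpha> * x_deriv s (x_deriv s Th) x t
           - observer_gain \<alpha> lam x (s t) * (deriv Y t / \<beta> + x_deriv s Th (s t) t))
          (at t within active_times s x)) \<and>
     (\<forall>t>0. - k * x_deriv s Th 0 t = qc t) \<and>
     (\<forall>t>0. Th (s t) t = Tm) \<and>
     (\<forall>x\<in>{0..s 0}. Th x 0 = Th0 x)"

definition L2_norm_sq :: "(real \<Rightarrow> real) \<Rightarrow> (real \<Rightarrow> real \<Rightarrow> real) \<Rightarrow> real \<Rightarrow> real" where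
  "L2_norm_sq s u t = integral {0..s t} (\<lambda>x. (u x t)\<^sup>2)"

definition H1_norm_sq :: "(real \<Rightarrow> real) \<Rightarrow> (real \<Rightarrow> real \<Rightarrow> real) \<Rightarrow> real \<Rightarrow> real" where
  "H1_norm_sq s u t = L2_norm_sq s u t + L2_norm_sq s (x_deriv s u) t"

end

(* With c = lam / alpha, the kernel Q(x,y) = c y J1(z)/z, z = sqrt(c (y^2 - x^2)), turns the observer
   error u into w = u - integral of Q(x,.) u over [x, s(t)], which solves the heat equation
   w_t = alpha w_xx - lam w with w_x(0) = 0 and w(s(t)) = 0. The map from u to w_x and its inverse are
   bounded (Volterra operators), so the H1 norm of u is equivalent to the L2 norm of w_x, and it is
   enough to show that E(t), the integral of w_x^2 over [0, s(t)], decays like exp (- 2 lam t).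

   Formally E' = - s'(t) w_x(s(t))^2 - 2 alpha |w_xx|^2 - 2 lam E, and s' >= 0 by the maximum
   principle for the temperature. Since w_x need not be differentiable in time, E' is replaced by the
   backward difference quotient: extending w(., t') by zero beyond s(t'), for t' < t,
   E(t) - E(t') <= - 2 * (integral over [0, s(t)] of w_xx(., t) (w(., t) - w(., t'))),
   which gives the differential inequality for the upper left Dini derivative of E. *)

theory Submission
  imports Defs
begin

text \<open>The kernel solves Q_xx - Q_yy = c Q with Q(x,x) = c x / 2 and Q_x(0,y) = 0. The observer
  gain is tied to it by a resolvent identity: the transformation maps the profile p(x) = (c S / 2)
  \<open>phi 1 (c / 4 * (S\<^sup>2 - x\<^sup>2))\<close> to Q(x,S). This cancels the boundary term
  Q(x,S) u_x(S) that integration by parts produces, so that no source is left in the equation of w.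
  The motion of the front contributes nothing to w_t because u vanishes there. A classical solution
  has continuous u_t and u_xx, but u_x is not assumed to have a time derivative; this is the
  obstacle to computing E'. Time difference quotients of u converge pointwise below the front and
  stay bounded up to it, hence converge in L1, which suffices for a pairing with the continuous
  w_xx. At t = 0 the slope may be missing at finitely many points, so continuity of E there comes
  from bounded convergence. All constants come from bounds of the kernel on a square whose side
  depends only on the setpoint.\<close>

section \<open>The power series \<open>phi\<close> and its differential equation\<close>

text \<open>In terms of Bessel functions, \<open>phi 1 (z\<^sup>2 / 4) / 2 = I\<^sub>1 z / z\<close> and
  \<open>phi 1 (- z\<^sup>2 / 4) / 2 = J\<^sub>1 z / z\<close>.\<close>

definition phi :: "nat \<Rightarrow> real \<Rightarrow> real" where
  "phi k z = (\<Sum>m. inverse (fact m * fact (m + k)) * z ^ m)"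

lemma summable_phi: "summable (\<lambda>m. inverse (fact m * fact (m + k)) * z ^ m)" for z :: real
proof (rule summable_comparison_test)
  show "summable (\<lambda>m. inverse (fact m) * \<bar>z\<bar> ^ m)"
    by (rule summable_exp)
  have "inverse (fact m * fact (m + k)) * \<bar>z\<bar> ^ m \<le> inverse (fact m) * \<bar>z\<bar> ^ m" for m
    by (intro mult_right_mono le_imp_inverse_le) (auto simp: fact_ge_1)
  then show "\<exists>N. \<forall>n\<ge>N. norm (inverse (fact n * fact (n + k)) * z ^ n) \<le> inverse (fact n) * \<bar>z\<bar> ^ n"
    by (auto simp: abs_mult power_abs)
qed

lemma phi_0 [simp]: "phi k 0 = inverse (fact k)"
  unfolding phi_def by (subst powser_zero) simp

text \<open>Termwise differentiation cancels the new factor m + 1 against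
  \<open>fact (Suc m)\<close> and leaves a shift in the other factorial. The family is thus closed
  under differentiation, without the square roots that Bessel functions of z would bring in.\<close>

lemma DERIV_phi: "(phi k has_real_derivative phi (Suc k) z) (at z)"
proof -
  have d: "diffs (\<lambda>m. inverse (fact m * fact (m + k))) = (\<lambda>m. inverse (fact m * fact (m + Suc k)) :: real)"
  proof
    fix m
    have "fact (Suc m) = real (Suc m) * fact m" by (rule fact_Suc)
    then have "real (Suc m) * inverse (fact (Suc m) * F) = inverse (fact m * F)" for F
      by (simp del: of_nat_Suc fact_Suc)
    then show "diffs (\<lambda>m. inverse (fact m * fact (m + k))) m = (inverse (fact m * fact (m + Suc k)) :: real)"
      unfolding diffs_def add_Suc_shift .
  qed
  have "((\<lambda>z. \<Sum>m. inverse (fact m * fact (m + k)) * z ^ m) has_real_derivative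
      (\<Sum>m. diffs (\<lambda>m. inverse (fact m * fact (m + k))) m * z ^ m)) (at z)"
    by (rule termdiffs_strong_converges_everywhere) (rule summable_phi)
  then show ?thesis unfolding d phi_def[abs_def] .
qed

lemma has_real_derivative_phi [derivative_intros]:
  "(f has_real_derivative D) (at x within A) \<Longrightarrow>
   ((\<lambda>x. phi k (f x)) has_real_derivative phi (Suc k) (f x) * D) (at x within A)"
  by (rule DERIV_chain2[OF DERIV_phi])

lemma continuous_on_phi [continuous_intros]:
  "continuous_on A f \<Longrightarrow> continuous_on A (\<lambda>x. phi k (f x))"
  by (rule continuous_on_compose2[of UNIV "phi k" A f])
    (use DERIV_isCont[OF DERIV_phi] in \<open>simp_all add: continuous_on_eq_continuous_at\<close>)

text \<open>On coefficients, 1 / (m+k)! = (m+k+1) / (m+k+1)!. The summand k + 1 produces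
  \<open>phi (Suc k)\<close>; the summand m cancels against \<open>fact m\<close> and, after an
  index shift, produces the last term. Through \<open>DERIV_phi\<close> this is the differential
  equation z f'' + (k+1) f' = f for f = \<open>phi k\<close>.\<close>

lemma phi_recurrence: "phi k z = (real k + 1) * phi (Suc k) z + z * phi (Suc (Suc k)) z"
proof -
  have 1: "inverse (fact m * fact (m + k)) * z ^ m
      - (real k + 1) * (inverse (fact m * fact (m + Suc k)) * z ^ m)
      = real m * (inverse (fact m * fact (m + Suc k)) * z ^ m)" for m
  proof -
    have "inverse (fact (m + k)) = (real m + real k + 1) * inverse (fact (m + Suc k))"
    proof -
      have "fact (m + Suc k) = (real m + real k + 1) * fact (m + k)"
        by (simp add: algebra_simps)
      moreover have "real m + real k + 1 \<noteq> 0"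
        using of_nat_0_le_iff[of m, where ?'a = real] of_nat_0_le_iff[of k, where ?'a = real]
        by linarith
      ultimately show ?thesis by (simp del: fact_Suc add_Suc_right)
    qed
    then have "inverse (fact m * fact (m + k)) = (real m + real k + 1) * inverse (fact m * fact (m + Suc k))"
      by (simp del: fact_Suc add_Suc_right)
    then show ?thesis by (simp only: ring_distribs mult.assoc)
  qed
  have 2: "(\<lambda>m. real m * (inverse (fact m * fact (m + Suc k)) * z ^ m)) sums
      (phi k z - (real k + 1) * phi (Suc k) z)"
    unfolding 1[symmetric] phi_def
    by (intro sums_diff sums_mult summable_sums summable_phi)
  have "(\<lambda>m. z * (inverse (fact m * fact (m + Suc (Suc k))) * z ^ m)) sums (z * phi (Suc (Suc k)) z)"
    unfolding phi_def by (intro sums_mult summable_sums summable_phi)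
  also have "(\<lambda>m. z * (inverse (fact m * fact (m + Suc (Suc k))) * z ^ m)) =
      (\<lambda>m. real (Suc m) * (inverse (fact (Suc m) * fact (Suc m + Suc k)) * z ^ Suc m))"
  proof
    fix m
    have "fact (Suc m) = real (Suc m) * fact m" by (rule fact_Suc)
    then have "real (Suc m) * (inverse (fact (Suc m) * F) * z ^ Suc m) = z * (inverse (fact m * F) * z ^ m)" for F
      by (simp del: of_nat_Suc fact_Suc)
    then show "z * (inverse (fact m * fact (m + Suc (Suc k))) * z ^ m) =
        real (Suc m) * (inverse (fact (Suc m) * fact (Suc m + Suc k)) * z ^ Suc m)"
      unfolding add_Suc_shift by (rule sym)
  qed
  \<comment> \<open>The term of index 0 carries the factor \<open>real m\<close> and vanishes, so
    the index shift costs nothing.\<close>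
  finally have "(\<lambda>m. real m * (inverse (fact m * fact (m + Suc k)) * z ^ m)) sums (z * phi (Suc (Suc k)) z)"
    by (subst (asm) sums_Suc_iff) simp
  from sums_unique2[OF this 2] show ?thesis by simp
qed

text \<open>The odd powers leave one factor \<open>sqrt r / 2\<close>, which the quotient cancels;
  what remains is a power series in r. At r = 0 its value is 1/2, which agrees with the continuous
  extension.\<close>

lemma bessel_I1_quot_sqrt:
  assumes "0 \<le> r"
  shows "bessel_I1_quot (sqrt r) = phi 1 (r / 4) / 2"
proof (cases "r = 0")
  case False
  have "(\<lambda>m. (sqrt r / 2) ^ (2 * m + 1) / (fact m * fact (m + 1))) =
      (\<lambda>m. sqrt r / 2 * (inverse (fact m * fact (m + 1)) * (r / 4) ^ m))"
  proof
    fix m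
    have "(sqrt r / 2)\<^sup>2 = r / 4" using assms by (simp add: power_divide)
    moreover have "(sqrt r / 2) ^ (2 * m + 1) = ((sqrt r / 2)\<^sup>2) ^ m * (sqrt r / 2)"
      by (simp only: power_add power_mult power_one_right)
    ultimately have "(sqrt r / 2) ^ (2 * m + 1) = sqrt r / 2 * (r / 4) ^ m"
      by (simp only: mult.commute)
    then show "(sqrt r / 2) ^ (2 * m + 1) / (fact m * fact (m + 1)) =
        sqrt r / 2 * (inverse (fact m * fact (m + 1)) * (r / 4) ^ m)"
      by (simp only: divide_inverse mult_ac)
  qed
  then have "bessel_I1 (sqrt r) = sqrt r / 2 * phi 1 (r / 4)"
    unfolding bessel_I1_def phi_def by (simp only: suminf_mult[OF summable_phi])
  then show ?thesis
    using False by (simp add: bessel_I1_quot_def)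
qed (simp add: bessel_I1_quot_def)

lemma observer_gain_phi:
  assumes "0 < \<alpha>" "0 < lam" "0 \<le> x" "x \<le> \<sigma>"
  shows "observer_gain \<alpha> lam x \<sigma> = - lam * \<sigma> / 2 * phi 1 (lam / \<alpha> / 4 * (\<sigma>\<^sup>2 - x\<^sup>2))"
proof -
  have "x\<^sup>2 \<le> \<sigma>\<^sup>2" using assms by (intro power_mono) auto
  then have "0 \<le> lam / \<alpha> * (\<sigma>\<^sup>2 - x\<^sup>2)" using assms by simp
  from bessel_I1_quot_sqrt[OF this] show ?thesis by (simp add: observer_gain_def)
qed

section \<open>The kernel of the transformation, its derivatives and its resolvent\<close>

text \<open>Written through \<open>phi\<close>, the kernel is smooth on the whole plane.
  Differentiation under the integral can therefore ignore that only the triangle x \<le> y matters,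
  where z = sqrt(c (y^2 - x^2)) is real for c > 0.\<close>

definition ker :: "real \<Rightarrow> real \<Rightarrow> real \<Rightarrow> real" where
  "ker c x y = c * y / 2 * phi 1 (- c / 4 * (y\<^sup>2 - x\<^sup>2))"

definition ker_x :: "real \<Rightarrow> real \<Rightarrow> real \<Rightarrow> real" where
  "ker_x c x y = c * y / 2 * (c * x / 2) * phi 2 (- c / 4 * (y\<^sup>2 - x\<^sup>2))"

definition ker_xx :: "real \<Rightarrow> real \<Rightarrow> real \<Rightarrow> real" where
  "ker_xx c x y = c * y / 2 * (c / 2 * phi 2 (- c / 4 * (y\<^sup>2 - x\<^sup>2))
     + (c * x / 2)\<^sup>2 * phi 3 (- c / 4 * (y\<^sup>2 - x\<^sup>2)))"

definition ker_y :: "real \<Rightarrow> real \<Rightarrow> real \<Rightarrow> real" where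
  "ker_y c x y = c / 2 * (phi 1 (- c / 4 * (y\<^sup>2 - x\<^sup>2)) - c / 2 * y\<^sup>2 * phi 2 (- c / 4 * (y\<^sup>2 - x\<^sup>2)))"

text \<open>The second identity is the first one differentiated along the diagonal. Together they
  evaluate the boundary terms at y = x, both in the derivatives of w and in the integration by
  parts.\<close>

lemma ker_diag: "ker c x x = c * x / 2" "ker_x c x x + ker_y c x x = c / 2"
  by (simp_all add: ker_def ker_x_def ker_y_def power2_eq_square right_diff_distrib)

lemma DERIV_ker:
  "((\<lambda>x. ker c x y) has_real_derivative ker_x c x y) (at x within A)"
  "((\<lambda>x. ker_x c x y) has_real_derivative ker_xx c x y) (at x within A)"
  "((\<lambda>y. ker c x y) has_real_derivative ker_y c x y) (at y within A)"
proof -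
  have x: "((\<lambda>x. - c / 4 * (y\<^sup>2 - x\<^sup>2)) has_real_derivative c * x / 2) (at x within A)"
    and y: "((\<lambda>y. - c / 4 * (y\<^sup>2 - x\<^sup>2)) has_real_derivative - c * y / 2) (at y within A)"
    and l: "((\<lambda>x. c * y / 2 * (c * x / 2)) has_real_derivative c * y / 2 * (c / 2)) (at x within A)"
    and l': "((\<lambda>y. c * y / 2) has_real_derivative c / 2) (at y within A)"
    by (auto intro!: derivative_eq_intros)
  note n = numeral_2_eq_2 numeral_3_eq_3
  show "((\<lambda>x. ker c x y) has_real_derivative ker_x c x y) (at x within A)"
    unfolding ker_def ker_x_def
    by (rule DERIV_cong[OF DERIV_cmult[OF has_real_derivative_phi[OF x]]]) (simp add: n)
  show "((\<lambda>x. ker_x c x y) has_real_derivative ker_xx c x y) (at x within A)"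
    unfolding ker_x_def ker_xx_def
    by (rule DERIV_cong[OF DERIV_mult[OF l has_real_derivative_phi[OF x]]])
      (simp add: n power2_eq_square ring_distribs mult_ac)
  show "((\<lambda>y. ker c x y) has_real_derivative ker_y c x y) (at y within A)"
    unfolding ker_def ker_y_def
    by (rule DERIV_cong[OF DERIV_mult[OF l' has_real_derivative_phi[OF y]]])
      (simp add: n power2_eq_square ring_distribs)
qed

text \<open>Differentiation leaves only \<open>phi 2\<close> and \<open>phi 3\<close>, and the
  recurrence of index 1 expresses the kernel itself through the same two. The outcome is the kernel
  equation Q_yy = Q_xx - c Q; with c = lam / \<alpha> its last term becomes the damping - lam
  w.\<close>

lemma DERIV_ker_y:
  "((\<lambda>y. ker_y c x y) has_real_derivative ker_xx c x y - c * ker c x y) (at y within A)"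
proof -
  let ?z = "- c / 4 * (y\<^sup>2 - x\<^sup>2)"
  have z: "((\<lambda>y. - c / 4 * (y\<^sup>2 - x\<^sup>2)) has_real_derivative - c / 2 * y) (at y within A)"
    by (auto intro!: derivative_eq_intros)
  have p1: "((\<lambda>y. phi 1 (- c / 4 * (y\<^sup>2 - x\<^sup>2))) has_real_derivative phi 2 ?z * (- c / 2 * y)) (at y within A)"
    using has_real_derivative_phi[OF z, of 1] by (simp add: numeral_2_eq_2)
  have p2: "((\<lambda>y. phi 2 (- c / 4 * (y\<^sup>2 - x\<^sup>2))) has_real_derivative phi 3 ?z * (- c / 2 * y)) (at y within A)"
    using has_real_derivative_phi[OF z, of 2] by (simp add: numeral_3_eq_3)
  have y2: "((\<lambda>y. c / 2 * y\<^sup>2) has_real_derivative c * y) (at y within A)"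
    by (auto intro!: derivative_eq_intros)
  have "((\<lambda>y. ker_y c x y) has_real_derivative
     c / 2 * (phi 2 ?z * (- c / 2 * y) - (c * y * phi 2 ?z + phi 3 ?z * (- c / 2 * y) * (c / 2 * y\<^sup>2))))
     (at y within A)"
    unfolding ker_y_def by (intro DERIV_cmult DERIV_diff DERIV_mult p1 p2 y2)
  moreover have "phi 1 ?z = 2 * phi 2 ?z + ?z * phi 3 ?z"
    using phi_recurrence[of 1 ?z] by (simp add: numeral_2_eq_2 numeral_3_eq_3)
  moreover have "c / 2 * (q * (- c / 2 * y) - (c * y * q + r * (- c / 2 * y) * (c / 2 * y\<^sup>2)))
      = c * y / 2 * (c / 2 * q + (c * x / 2)\<^sup>2 * r) - c * (c * y / 2 * (2 * q + ?z * r))" for q r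
    by (simp add: power2_eq_square field_simps)
  ultimately show ?thesis
    by (simp only: ker_xx_def ker_def)
qed

lemma continuous_on_ker [continuous_intros]:
  assumes "continuous_on A f" "continuous_on A g"
  shows "continuous_on A (\<lambda>x. ker c (f x) (g x))" "continuous_on A (\<lambda>x. ker_x c (f x) (g x))"
    "continuous_on A (\<lambda>x. ker_xx c (f x) (g x))"
proof -
  have "continuous_on A (\<lambda>x. - c / 4 * ((g x)\<^sup>2 - (f x)\<^sup>2))"
    by (intro continuous_intros assms)
  note * = continuous_on_phi[OF this]
  show "continuous_on A (\<lambda>x. ker c (f x) (g x))" "continuous_on A (\<lambda>x. ker_x c (f x) (g x))"
    "continuous_on A (\<lambda>x. ker_xx c (f x) (g x))"
    unfolding ker_def ker_x_def ker_xx_def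
    by (intro continuous_on_mult continuous_on_add continuous_on_power continuous_on_const
          continuous_on_divide * assms ballI; simp)+
qed

text \<open>The convolution identity behind the inverse transformation: with \<open>A z = z * phi 1 z\<close> and
  \<open>B = phi 0 = A'\<close>, the product \<open>A (- g v) B (g (D - v)) - B (- g v) A (g (D - v))\<close> is a primitive
  of \<open>g\<^sup>2 D * phi 1 (- g v) * phi 1 (g (D - v))\<close>.\<close>

lemma ker_resolvent:
  assumes "0 < c" "0 \<le> x" "x \<le> S"
  shows "((\<lambda>y. ker c x y * (c * S / 2 * phi 1 (c / 4 * (S\<^sup>2 - y\<^sup>2)))) has_integral
          c * S / 2 * phi 1 (c / 4 * (S\<^sup>2 - x\<^sup>2)) - ker c x S) {x..S}"
proof (cases "x = S")
  case True
  then show ?thesis using has_integral_refl(2)[of _ S] by (simp add: ker_def)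
next
  case False
  define g where "g = c / 4"
  define D where "D = S\<^sup>2 - x\<^sup>2"
  have D: "D > 0" unfolding D_def using assms False by (simp add: power2_eq_square mult_strict_mono')
  have c: "c = 4 * g" by (simp add: g_def)
  define A where "A = (\<lambda>z. z * phi 1 z)"
  have dA: "((\<lambda>y. A (f y)) has_real_derivative phi 0 (f y) * d) (at y within X)"
    if "(f has_real_derivative d) (at y within X)" for f d y X
  proof -
    have "(A has_real_derivative phi 0 z) (at z)" for z
      unfolding A_def
      using DERIV_mult[OF DERIV_ident DERIV_phi[of 1 z]] phi_recurrence[of 0 z]
      by (simp add: mult.commute)
    from DERIV_chain2[OF this that] show ?thesis .
  qed
  let ?G = "\<lambda>y. A (- g * (y\<^sup>2 - x\<^sup>2)) * phi 0 (g * (S\<^sup>2 - y\<^sup>2)) - phi 0 (- g * (y\<^sup>2 - x\<^sup>2)) * A (g * (S\<^sup>2 - y\<^sup>2))"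
  have deriv: "(?G has_real_derivative 2 * g\<^sup>2 * D * (y * (phi 1 (- g * (y\<^sup>2 - x\<^sup>2)) * phi 1 (g * (S\<^sup>2 - y\<^sup>2)))))
      (at y within X)" for y X
  proof -
    have a: "((\<lambda>y. - g * (y\<^sup>2 - x\<^sup>2)) has_real_derivative - 2 * g * y) (at y within X)"
      and b: "((\<lambda>y. g * (S\<^sup>2 - y\<^sup>2)) has_real_derivative - 2 * g * y) (at y within X)"
      by (auto intro!: derivative_eq_intros)
    have D: "D = (S\<^sup>2 - y\<^sup>2) + (y\<^sup>2 - x\<^sup>2)" by (simp add: D_def)
    show ?thesis
      by (rule DERIV_cong[OF DERIV_diff[OF DERIV_mult[OF dA[OF a] has_real_derivative_phi[OF b]]
              DERIV_mult[OF has_real_derivative_phi[OF a] dA[OF b]]]])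
        (simp add: A_def D power2_eq_square algebra_simps)
  qed
  let ?p = "\<lambda>y. y * (phi 1 (- g * (y\<^sup>2 - x\<^sup>2)) * phi 1 (g * (S\<^sup>2 - y\<^sup>2)))"
  have "((\<lambda>y. 2 * g\<^sup>2 * D * ?p y) has_integral ?G S - ?G x) {x..S}"
    using deriv assms unfolding has_real_derivative_iff_has_vector_derivative
    by (intro fundamental_theorem_of_calculus) auto
  \<comment> \<open>The primitive has derivative 2 g^2 D times \<open>?p\<close>, while the
    integrand in question is 4 S g^2 times \<open>?p\<close>; the ratio is 2 S / D. This division is
    why x = S, where D = 0, is a separate case.\<close>
  from has_integral_mult_right[OF this, of "2 * S / D"]
  have "((\<lambda>y. 2 * S / D * (2 * g\<^sup>2 * D * ?p y)) has_integral 2 * S / D * (?G S - ?G x)) {x..S}" .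
  moreover have "2 * S / D * (2 * g\<^sup>2 * D * ?p y) = ker c x y * (c * S / 2 * phi 1 (c / 4 * (S\<^sup>2 - y\<^sup>2)))" for y
  proof -
    have "2 * S / D * (2 * g\<^sup>2 * D * r) = 4 * S * g\<^sup>2 * r" for r using D by simp
    moreover have "ker c x y * (c * S / 2 * phi 1 (c / 4 * (S\<^sup>2 - y\<^sup>2))) = 4 * S * g\<^sup>2 * ?p y"
      unfolding ker_def c power2_eq_square[of g] by simp
    ultimately show ?thesis by (simp only:)
  qed
  moreover have "?G S - ?G x = g * D * (phi 1 (g * D) - phi 1 (- g * D))"
    by (simp add: A_def D_def algebra_simps)
  moreover have "2 * S / D * (g * D * (phi 1 (g * D) - phi 1 (- g * D)))
      = c * S / 2 * phi 1 (c / 4 * (S\<^sup>2 - x\<^sup>2)) - ker c x S"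
    using D by (simp add: ker_def c D_def[symmetric] right_diff_distrib)
  ultimately show ?thesis by (simp only:)
qed

section \<open>The Volterra transformation at a fixed time\<close>

text \<open>The variable occurs both in the kernel and as lower limit. The two roles are separated
  into q and p: the Leibniz rule gives the q-derivative, the fundamental theorem of calculus the
  p-derivative, and the chain rule along q = p = x adds them.\<close>

lemma DERIV_integral_lower:
  fixes K K' :: "real \<Rightarrow> real \<Rightarrow> real"
  assumes K': "\<And>x y. ((\<lambda>x. K x y) has_real_derivative K' x y) (at x within {a..b})"
    and cont: "continuous_on UNIV (\<lambda>(x, y). K x y)" "continuous_on UNIV (\<lambda>(x, y). K' x y)"
    and v: "continuous_on {a..b} v" and x: "x \<in> {a..b}"
  shows "((\<lambda>x. integral {x..b} (\<lambda>y. K x y * v y)) has_real_derivative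
    integral {x..b} (\<lambda>y. K' x y * v y) - K x x * v x) (at x within {a..b})"
proof -
  have cK: "continuous_on A (\<lambda>z. K (f z) (g z))" "continuous_on A (\<lambda>z. K' (f z) (g z))"
    if "continuous_on A f" "continuous_on A g" for A :: "'z::topological_space set" and f g
    using continuous_on_compose2[OF cont(1) continuous_on_Pair[OF that]]
      continuous_on_compose2[OF cont(2) continuous_on_Pair[OF that]] by auto
  have vx: "continuous_on {x..b} v" using v x by (auto elim: continuous_on_subset)
  let ?I = "integral {x..b} (\<lambda>y. K' x y * v y)"
  have fx: "((\<lambda>q. integral {x..b} (\<lambda>y. K q y * v y)) has_real_derivative ?I) (at x within {a..b})"
    using x
    by (intro leibniz_rule_field_derivative[where b = b and a = x and fx = "\<lambda>q y. K' q y * v y",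
          unfolded cbox_interval] DERIV_cmult_right K' integrable_continuous_real)
      (auto simp: split_beta intro!: continuous_intros cK vx continuous_on_compose2[OF vx])
  have fy: "((\<lambda>p. integral {p..b} (\<lambda>y. K q y * v y)) has_real_derivative - (K q p * v p))
      (at p within {a..b})" if "p \<in> {a..b}" for q p
    by (rule integral_has_real_derivative') (use that in \<open>auto intro!: continuous_intros cK v\<close>)
  \<comment> \<open>A total derivative follows from the two partial ones because the p-derivative is
    jointly continuous at (x, x); that continuity is stated for linear maps, hence the
    \<open>blinfun\<close> wrapping.\<close>
  have *: "((\<lambda>(q, p). integral {p..b} (\<lambda>y. K q y * v y)) has_derivative
     (\<lambda>(tq, tp). ?I * tq + blinfun_apply (blinfun_mult_right (- (K x x * v x))) tp))
     (at (x, x) within {a..b} \<times> {a..b})"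
  proof (rule has_derivative_partialsI[where fy = "\<lambda>q p. blinfun_mult_right (- (K q p * v p))"])
    show "((\<lambda>q. integral {x..b} (\<lambda>y. K q y * v y)) has_derivative (*) ?I) (at x within {a..b})"
      using fx by (simp add: has_field_derivative_def)
    show "((\<lambda>p. integral {p..b} (\<lambda>y. K q y * v y)) has_derivative
       blinfun_apply (blinfun_mult_right (- (K q p * v p)))) (at p within {a..b})"
      if "p \<in> {a..b}" for q p
      using fy[OF that, of q] by (simp add: has_field_derivative_def blinfun_mult_right.rep_eq)
    have "continuous_on ({a..b} \<times> {a..b}) (\<lambda>(q, p). blinfun_mult_right (- (K q p * v p)))"
      unfolding split_beta
      by (intro bounded_linear.continuous_on[OF bounded_linear_blinfun_mult_right]
           continuous_intros cK continuous_on_compose2[OF v]) auto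
    then show "continuous (at (x, x) within {a..b} \<times> {a..b}) (\<lambda>(q, p). blinfun_mult_right (- (K q p * v p)))"
      using x by (simp add: continuous_on_eq_continuous_within)
  qed (use x in auto)
  have "((\<lambda>x. (x, x)) has_derivative (\<lambda>t. (t, t))) (at x within {a..b})"
    by (intro derivative_intros)
  moreover have "((\<lambda>(q, p). integral {p..b} (\<lambda>y. K q y * v y)) has_derivative
     (\<lambda>(tq, tp). ?I * tq + blinfun_apply (blinfun_mult_right (- (K x x * v x))) tp))
     (at (x, x) within (\<lambda>x. (x, x)) ` {a..b})"
    using * by (rule has_derivative_subset) auto
  ultimately have "((\<lambda>x. (\<lambda>(q, p). integral {p..b} (\<lambda>y. K q y * v y)) (x, x)) has_derivative
     (\<lambda>t. (\<lambda>(tq, tp). ?I * tq + blinfun_apply (blinfun_mult_right (- (K x x * v x))) tp) (t, t)))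
     (at x within {a..b})"
    by (rule has_derivative_in_compose)
  moreover have "(\<lambda>t. (\<lambda>(tq, tp). ?I * tq + blinfun_apply (blinfun_mult_right (- (K x x * v x))) tp) (t, t))
      = (*) (?I - K x x * v x)"
    by (rule ext) (simp add: blinfun_mult_right.rep_eq left_diff_distrib)
  ultimately show ?thesis
    by (simp only: has_field_derivative_def prod.case)
qed

text \<open>The backstepping map from the error u to the target state w, with time frozen: S stands
  for s(t) and v for u(., t).\<close>

definition bstep :: "real \<Rightarrow> real \<Rightarrow> (real \<Rightarrow> real) \<Rightarrow> real \<Rightarrow> real" where
  "bstep c S v x = v x - integral {x..S} (\<lambda>y. ker c x y * v y)"

text \<open>The slope v' is a separate argument, so that the expression also makes sense at t = 0,
  where the profile may fail to be differentiable at finitely many points.\<close>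

definition bstep_x :: "real \<Rightarrow> real \<Rightarrow> (real \<Rightarrow> real) \<Rightarrow> (real \<Rightarrow> real) \<Rightarrow> real \<Rightarrow> real" where
  "bstep_x c S v v' x = v' x + c * x / 2 * v x - integral {x..S} (\<lambda>y. ker_x c x y * v y)"

definition bstep_xx ::
  "real \<Rightarrow> real \<Rightarrow> (real \<Rightarrow> real) \<Rightarrow> (real \<Rightarrow> real) \<Rightarrow> (real \<Rightarrow> real) \<Rightarrow> real \<Rightarrow> real" where
  "bstep_xx c S v v' v'' x = v'' x + c / 2 * v x + c * x / 2 * v' x + ker_x c x x * v x
     - integral {x..S} (\<lambda>y. ker_xx c x y * v y)"

lemma continuous_on_ker_pair:
  "continuous_on UNIV (\<lambda>(x, y). ker c x y)" "continuous_on UNIV (\<lambda>(x, y). ker_x c x y)"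
  "continuous_on UNIV (\<lambda>(x, y). ker_xx c x y)"
  unfolding split_beta by (intro continuous_intros)+

lemma DERIV_bstep:
  assumes v: "continuous_on {0..S} v" and x: "x \<in> {0..S}"
    and "(v has_real_derivative v' x) (at x within {0..S})"
  shows "(bstep c S v has_real_derivative bstep_x c S v v' x) (at x within {0..S})"
  using DERIV_diff[OF assms(3) DERIV_integral_lower[OF DERIV_ker(1) continuous_on_ker_pair(1,2) v x]]
  by (simp add: bstep_def[abs_def] bstep_x_def ker_diag algebra_simps)

lemma DERIV_bstep_x:
  assumes v: "continuous_on {0..S} v" and x: "x \<in> {0..S}"
    and v': "(v has_real_derivative v' x) (at x within {0..S})"
    and v'': "(v' has_real_derivative v'' x) (at x within {0..S})"
  shows "(bstep_x c S v v' has_real_derivative bstep_xx c S v v' v'' x) (at x within {0..S})"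
proof -
  have "((\<lambda>x. c * x / 2) has_real_derivative c / 2) (at x within {0..S})"
    by (auto intro!: derivative_eq_intros)
  from DERIV_diff[OF DERIV_add[OF v'' DERIV_mult[OF this v']]
      DERIV_integral_lower[OF DERIV_ker(2) continuous_on_ker_pair(2,3) v x]]
  show ?thesis
    by (simp add: bstep_x_def[abs_def] bstep_xx_def algebra_simps)
qed

lemma bstep_end [simp]: "bstep c S v S = v S"
  by (simp add: bstep_def)

lemma ker_x_0 [simp]: "ker_x c 0 y = 0"
  by (simp add: ker_x_def)

lemma bstep_x_0: "bstep_x c S v v' 0 = v' 0"
  by (simp add: bstep_x_def)

text \<open>Only the integral term needs an argument. Splitting \<open>ker_xx\<close> into its
  \<open>phi 2\<close> and \<open>phi 3\<close> parts, with the factors in x taken out of the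
  integral, leaves kernels to which \<open>DERIV_integral_lower\<close> applies; the integrals are
  then even differentiable.\<close>

lemma continuous_on_bstep_xx:
  assumes v: "continuous_on {0..S} v" "continuous_on {0..S} v'" "continuous_on {0..S} v''"
  shows "continuous_on {0..S} (bstep_xx c S v v' v'')"
proof -
  let ?z = "\<lambda>x y. - c / 4 * (y\<^sup>2 - x\<^sup>2)"
  let ?K = "\<lambda>k x y. c * y / 2 * phi k (?z x y)"
  have z: "continuous_on A (\<lambda>p. ?z (f p) (g p))" if "continuous_on A f" "continuous_on A g"
    for A :: "'z::topological_space set" and f g
    by (intro continuous_intros that)
  have D: "continuous_on {0..S} (\<lambda>x. integral {x..S} (\<lambda>y. ?K k x y * v y))" for k
  proof (rule DERIV_continuous_on, rule DERIV_integral_lower)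
    show "((\<lambda>x. ?K k x y) has_real_derivative c * y / 2 * (phi (Suc k) (?z x y) * (c * x / 2)))
      (at x within {0..S})" for x y
      by (intro DERIV_cmult has_real_derivative_phi) (auto intro!: derivative_eq_intros)
    show "continuous_on UNIV (\<lambda>(x, y). ?K k x y)"
      "continuous_on UNIV (\<lambda>(x, y). c * y / 2 * (phi (Suc k) (?z x y) * (c * x / 2)))"
      unfolding split_beta
      by (intro continuous_on_mult continuous_on_phi z continuous_on_divide continuous_on_fst
          continuous_on_snd continuous_on_const continuous_on_id; simp)+
  qed (use v in auto)
  have eq: "integral {x..S} (\<lambda>y. ker_xx c x y * v y) = c / 2 * integral {x..S} (\<lambda>y. ?K 2 x y * v y)
      + (c * x / 2)\<^sup>2 * integral {x..S} (\<lambda>y. ?K 3 x y * v y)" if "x \<in> {0..S}" for x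
  proof -
    have "continuous_on {x..S} v" using v(1) that by (auto elim: continuous_on_subset)
    then have "(\<lambda>y. ?K k x y * v y) integrable_on {x..S}" for k
      by (intro integrable_continuous_real continuous_on_mult continuous_on_phi z continuous_on_divide
          continuous_on_const continuous_on_id) auto
    then have "((\<lambda>y. c / 2 * (?K 2 x y * v y) + (c * x / 2)\<^sup>2 * (?K 3 x y * v y)) has_integral
      c / 2 * integral {x..S} (\<lambda>y. ?K 2 x y * v y) + (c * x / 2)\<^sup>2 * integral {x..S} (\<lambda>y. ?K 3 x y * v y)) {x..S}"
      by (intro has_integral_add has_integral_mult_right integrable_integral)
    then show ?thesis
      by (subst integral_unique[symmetric]) (auto simp: ker_xx_def algebra_simps)
  qed
  have "continuous_on {0..S} (\<lambda>x. c / 2 * integral {x..S} (\<lambda>y. ?K 2 x y * v y)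
      + (c * x / 2)\<^sup>2 * integral {x..S} (\<lambda>y. ?K 3 x y * v y))"
    by (intro continuous_on_add continuous_on_mult continuous_on_power continuous_on_divide D
          continuous_on_const continuous_on_id) auto
  then have "continuous_on {0..S} (\<lambda>x. integral {x..S} (\<lambda>y. ker_xx c x y * v y))"
    by (rule continuous_on_eq) (rule eq[symmetric])
  then show ?thesis
    unfolding bstep_xx_def[abs_def] by (intro continuous_intros v) auto
qed

text \<open>Two integrations by parts move v'' onto the kernel, where the kernel equation turns it
  into the integral part of \<open>bstep_xx\<close> and the damping. At y = x the diagonal values
  match the local terms of \<open>bstep_xx\<close>. At y = S the term with v vanishes and the one
  with v' is cancelled by the gain, whose transform is \<open>ker c x S\<close> by
  \<open>ker_resolvent\<close>. The bracket on the left is the right-hand side of the equation for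
  u_t.\<close>

lemma bstep_equation:
  fixes c S lam \<alpha> :: real
  assumes pos: "0 < \<alpha>" "0 < lam" and c: "c = lam / \<alpha>"
    and v': "\<And>x. x \<in> {0..S} \<Longrightarrow> (v has_real_derivative v' x) (at x within {0..S})"
    and v'': "\<And>x. x \<in> {0..S} \<Longrightarrow> (v' has_real_derivative v'' x) (at x within {0..S})"
    and cont: "continuous_on {0..S} v''" and "v S = 0" and x: "x \<in> {0..S}"
  shows "bstep c S (\<lambda>y. \<alpha> * v'' y + lam * S / 2 * phi 1 (c / 4 * (S\<^sup>2 - y\<^sup>2)) * v' S) x
    = \<alpha> * bstep_xx c S v v' v'' x - lam * bstep c S v x"
proof -
  have lam: "lam = \<alpha> * c" using pos by (simp add: c)
  have cv: "continuous_on {0..S} v" by (rule DERIV_continuous_on) (rule v')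
  have cx: "continuous_on {x..S} f" if "continuous_on {0..S} f" for f :: "real \<Rightarrow> real"
    using that x by (auto elim: continuous_on_subset)
  have int: "(\<lambda>y. ker c x y * f y) integrable_on {x..S}" "(\<lambda>y. ker_xx c x y * f y) integrable_on {x..S}"
    if "continuous_on {0..S} f" for f
    by (intro integrable_continuous_real continuous_intros cx[OF that])+
  have "((\<lambda>y. ker c x y * v'' y - (ker_xx c x y - c * ker c x y) * v y) has_integral
      (ker c x S * v' S - ker_y c x S * v S) - (ker c x x * v' x - ker_y c x x * v x)) {x..S}"
  proof (rule fundamental_theorem_of_calculus)
    fix y assume y: "y \<in> {x..S}"
    have *: "(f has_real_derivative d) (at y within {x..S})"
      if "(f has_real_derivative d) (at y within {0..S})" for f d
      using that x by (auto elim: DERIV_subset)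
    show "((\<lambda>y. ker c x y * v' y - ker_y c x y * v y) has_vector_derivative
       ker c x y * v'' y - (ker_xx c x y - c * ker c x y) * v y) (at y within {x..S})"
      unfolding has_real_derivative_iff_has_vector_derivative[symmetric]
      using x y
      by (intro DERIV_cong[OF DERIV_diff[OF DERIV_mult[OF DERIV_ker(3) *[OF v'']]
              DERIV_mult[OF DERIV_ker_y *[OF v']]]]) (auto simp: algebra_simps)
  qed (use x in auto)
  then have "integral {x..S} (\<lambda>y. ker c x y * v'' y - (ker_xx c x y - c * ker c x y) * v y)
      = ker c x S * v' S - (ker c x x * v' x - ker_y c x x * v x)"
    using \<open>v S = 0\<close> by (simp add: integral_unique)
  moreover have "integral {x..S} (\<lambda>y. ker c x y * v'' y - (ker_xx c x y - c * ker c x y) * v y)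
     = integral {x..S} (\<lambda>y. ker c x y * v'' y) - integral {x..S} (\<lambda>y. ker_xx c x y * v y)
        + c * integral {x..S} (\<lambda>y. ker c x y * v y)"
  proof -
    have "((\<lambda>y. ker c x y * v'' y - ker_xx c x y * v y + c * (ker c x y * v y)) has_integral
       integral {x..S} (\<lambda>y. ker c x y * v'' y) - integral {x..S} (\<lambda>y. ker_xx c x y * v y)
        + c * integral {x..S} (\<lambda>y. ker c x y * v y)) {x..S}"
      by (intro has_integral_add has_integral_diff has_integral_mult_right integrable_integral int cv cont)
    then show ?thesis by (subst integral_unique[symmetric]) (auto simp: algebra_simps)
  qed
  ultimately have 1: "integral {x..S} (\<lambda>y. ker c x y * v'' y) = integral {x..S} (\<lambda>y. ker_xx c x y * v y)
      - c * integral {x..S} (\<lambda>y. ker c x y * v y) + ker c x S * v' S - (ker c x x * v' x - ker_y c x x * v x)"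
    by linarith
  let ?p = "\<lambda>y. c * S / 2 * phi 1 (c / 4 * (S\<^sup>2 - y\<^sup>2))"
  have "((\<lambda>y. \<alpha> * (ker c x y * v'' y) + \<alpha> * v' S * (ker c x y * ?p y)) has_integral
     \<alpha> * integral {x..S} (\<lambda>y. ker c x y * v'' y) + \<alpha> * v' S * (?p x - ker c x S)) {x..S}"
    using pos c x
    by (intro has_integral_add has_integral_mult_right integrable_integral int cont ker_resolvent) auto
  then have "integral {x..S} (\<lambda>y. ker c x y * (\<alpha> * v'' y + lam * S / 2 * phi 1 (c / 4 * (S\<^sup>2 - y\<^sup>2)) * v' S))
     = \<alpha> * integral {x..S} (\<lambda>y. ker c x y * v'' y) + \<alpha> * v' S * (?p x - ker c x S)"
    by (subst integral_unique[symmetric]) (auto simp: lam algebra_simps)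
  moreover have "ker_y c x x = c / 2 - ker_x c x x" using ker_diag(2)[of c x] by linarith
  ultimately show ?thesis
    unfolding bstep_def bstep_xx_def 1 by (simp add: ker_diag(1) lam algebra_simps)
qed

section \<open>Limits of integrals and the two energy inequalities\<close>

text \<open>Dominated convergence along every sequence of parameters tending to t. Setting the
  integrand to 0 at the exceptional points and at parameters violating the eventual bound makes the
  domination hold for all indices and points; the integrals agree eventually.\<close>

lemma bounded_convergence:
  fixes f :: "real \<Rightarrow> real \<Rightarrow> real"
  assumes N: "finite N"
    and ev: "\<forall>\<^sub>F \<tau> in at t within I. f \<tau> integrable_on {a..b} \<and> (\<forall>x\<in>{a..b} - N. \<bar>f \<tau> x\<bar> \<le> B)"
    and lim: "\<And>x. x \<in> {a..b} - N \<Longrightarrow> ((\<lambda>\<tau>. f \<tau> x) \<longlongrightarrow> g x) (at t within I)"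
    and nontrivial: "at t within I \<noteq> bot"
  shows "g integrable_on {a..b}"
    and "((\<lambda>\<tau>. integral {a..b} (f \<tau>)) \<longlongrightarrow> integral {a..b} g) (at t within I)"
proof -
  define good where "good = (\<lambda>\<tau>. f \<tau> integrable_on {a..b} \<and> (\<forall>x\<in>{a..b} - N. \<bar>f \<tau> x\<bar> \<le> B))"
  define F where "F = (\<lambda>\<tau> x. if x \<in> N \<or> \<not> good \<tau> then 0 else f \<tau> x)"
  define G where "G = (\<lambda>x. if x \<in> N then 0 else g x)"
  have F_int: "F \<tau> integrable_on {a..b}" for \<tau>
  proof (cases "good \<tau>")
    case True
    then show ?thesis
      by (intro integrable_spike_finite[OF N, of _ "F \<tau>" "f \<tau>"]) (auto simp: F_def good_def)
  next
    case False
    then have "F \<tau> = (\<lambda>x. 0)" by (auto simp: F_def)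
    then show ?thesis by (simp add: integrable_0)
  qed
  have F_eq: "integral {a..b} (F \<tau>) = integral {a..b} (f \<tau>)" if "good \<tau>" for \<tau>
    using that by (intro integral_spike[OF negligible_finite[OF N]]) (auto simp: F_def)
  have G_eq: "integral {a..b} G = integral {a..b} g"
    by (intro integral_spike[OF negligible_finite[OF N]]) (auto simp: G_def)
  have seq: "G integrable_on {a..b} \<and> (\<lambda>n. integral {a..b} (f (X n))) \<longlonglongrightarrow> integral {a..b} g"
    if X: "\<And>n. X n \<in> I - {t}" "X \<longlonglongrightarrow> t" for X
  proof -
    have flt: "filterlim X (at t within I) sequentially"
      using X by (auto simp: filterlim_at)
    have evX: "\<forall>\<^sub>F n in sequentially. good (X n)"
      using eventually_compose_filterlim[OF ev flt] by (simp add: good_def)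
    have conv: "(\<lambda>n. F (X n) x) \<longlonglongrightarrow> G x" if "x \<in> {a..b}" for x
    proof (cases "x \<in> N")
      case True
      then show ?thesis by (simp add: F_def G_def)
    next
      case False
      have "(\<lambda>n. f (X n) x) \<longlonglongrightarrow> g x"
        using filterlim_compose[OF lim flt] that False by auto
      moreover have "\<forall>\<^sub>F n in sequentially. f (X n) x = F (X n) x"
        using evX by eventually_elim (use False in \<open>auto simp: F_def\<close>)
      ultimately show ?thesis using False by (auto simp: G_def intro: Lim_transform_eventually)
    qed
    have bd: "norm (F (X n) x) \<le> \<bar>B\<bar>" if "x \<in> {a..b}" for n x
      using that by (auto simp: F_def good_def intro: order_trans[OF _ abs_ge_self])
    have "(\<lambda>x. \<bar>B\<bar>) integrable_on {a..b}" by (rule integrable_const_ivl)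
    from dominated_convergence[OF F_int this bd conv]
    have *: "G integrable_on {a..b}" "(\<lambda>n. integral {a..b} (F (X n))) \<longlonglongrightarrow> integral {a..b} G" by auto
    from evX have "\<forall>\<^sub>F n in sequentially. integral {a..b} (F (X n)) = integral {a..b} (f (X n))"
      by eventually_elim (rule F_eq)
    with * show ?thesis unfolding G_eq by (auto intro: Lim_transform_eventually)
  qed
  obtain X where "\<And>n. X n \<in> I - {t}" "X \<longlonglongrightarrow> t"
    using nontrivial unfolding trivial_limit_within islimpt_sequential by auto
  from seq[OF this] have "G integrable_on {a..b}" by simp
  then show "g integrable_on {a..b}"
    by (rule integrable_spike_finite[OF N, rotated]) (auto simp: G_def)
  show "((\<lambda>\<tau>. integral {a..b} (f \<tau>)) \<longlongrightarrow> integral {a..b} g) (at t within I)"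
    unfolding tendsto_at_iff_sequentially o_def using seq by blast
qed

text \<open>Integration by parts on {0..S1} and on {S1..S2} produces boundary terms at S1 that
  cancel; those at 0 and S2 vanish. On the first interval
  \<open>g\<^sub>2\<^sup>2 - g\<^sub>1\<^sup>2\<close> is at most
  \<open>2 * g\<^sub>2 * (g\<^sub>2 - g\<^sub>1)\<close>, which is where a time derivative of the
  slope is avoided. On the second, a nonnegative integral of \<open>g\<^sub>2\<^sup>2\<close> is
  left over and dropped; it is the counterpart of the term - s'(t) w_x(s(t))^2, and its sign uses
  that the front advances.\<close>

lemma energy_difference:
  fixes f\<^sub>1 f\<^sub>2 g\<^sub>1 g\<^sub>2 h\<^sub>2 :: "real \<Rightarrow> real"
  assumes S: "0 \<le> S\<^sub>1" "S\<^sub>1 \<le> S\<^sub>2"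
    and f1: "\<And>x. x \<in> {0..S\<^sub>1} \<Longrightarrow> (f\<^sub>1 has_real_derivative g\<^sub>1 x) (at x within {0..S\<^sub>1})"
    and g1: "continuous_on {0..S\<^sub>1} g\<^sub>1"
    and f2: "\<And>x. x \<in> {0..S\<^sub>2} \<Longrightarrow> (f\<^sub>2 has_real_derivative g\<^sub>2 x) (at x within {0..S\<^sub>2})"
    and g2: "\<And>x. x \<in> {0..S\<^sub>2} \<Longrightarrow> (g\<^sub>2 has_real_derivative h\<^sub>2 x) (at x within {0..S\<^sub>2})"
    and h2: "continuous_on {0..S\<^sub>2} h\<^sub>2"
    and bc: "f\<^sub>1 S\<^sub>1 = 0" "f\<^sub>2 S\<^sub>2 = 0" "g\<^sub>2 0 = 0"
  shows "integral {0..S\<^sub>2} (\<lambda>x. (g\<^sub>2 x)\<^sup>2) - integral {0..S\<^sub>1} (\<lambda>x. (g\<^sub>1 x)\<^sup>2)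
    \<le> - 2 * integral {0..S\<^sub>2} (\<lambda>x. h\<^sub>2 x * (f\<^sub>2 x - (if x \<le> S\<^sub>1 then f\<^sub>1 x else 0)))"
proof -
  have sub: "{0..S\<^sub>1} \<subseteq> {0..S\<^sub>2}" "{S\<^sub>1..S\<^sub>2} \<subseteq> {0..S\<^sub>2}" using S by auto
  have c2: "continuous_on {0..S\<^sub>2} f\<^sub>2" "continuous_on {0..S\<^sub>2} g\<^sub>2"
    using DERIV_continuous_on f2 g2 by blast+
  have c1: "continuous_on {0..S\<^sub>1} f\<^sub>1" using DERIV_continuous_on f1 by blast
  note cont = c1 g1 c2 h2 continuous_on_subset[OF c2(1) sub(1)] continuous_on_subset[OF c2(2) sub(1)]
    continuous_on_subset[OF h2 sub(1)] continuous_on_subset[OF c2(1) sub(2)]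
    continuous_on_subset[OF c2(2) sub(2)] continuous_on_subset[OF h2 sub(2)]
  have A: "((\<lambda>x. h\<^sub>2 x * (f\<^sub>2 x - f\<^sub>1 x) + g\<^sub>2 x * (g\<^sub>2 x - g\<^sub>1 x)) has_integral
      g\<^sub>2 S\<^sub>1 * (f\<^sub>2 S\<^sub>1 - f\<^sub>1 S\<^sub>1) - g\<^sub>2 0 * (f\<^sub>2 0 - f\<^sub>1 0)) {0..S\<^sub>1}"
  proof (rule fundamental_theorem_of_calculus)
    fix x assume x: "x \<in> {0..S\<^sub>1}"
    then have x': "x \<in> {0..S\<^sub>2}" using sub by auto
    show "((\<lambda>x. g\<^sub>2 x * (f\<^sub>2 x - f\<^sub>1 x)) has_vector_derivative
       h\<^sub>2 x * (f\<^sub>2 x - f\<^sub>1 x) + g\<^sub>2 x * (g\<^sub>2 x - g\<^sub>1 x)) (at x within {0..S\<^sub>1})"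
      unfolding has_real_derivative_iff_has_vector_derivative[symmetric]
      by (rule DERIV_cong[OF DERIV_mult[OF DERIV_subset[OF g2[OF x'] sub(1)]
            DERIV_diff[OF DERIV_subset[OF f2[OF x'] sub(1)] f1[OF x]]]]) simp
  qed (use S in auto)
  have B: "((\<lambda>x. h\<^sub>2 x * f\<^sub>2 x + (g\<^sub>2 x)\<^sup>2) has_integral g\<^sub>2 S\<^sub>2 * f\<^sub>2 S\<^sub>2 - g\<^sub>2 S\<^sub>1 * f\<^sub>2 S\<^sub>1) {S\<^sub>1..S\<^sub>2}"
  proof (rule fundamental_theorem_of_calculus)
    fix x assume "x \<in> {S\<^sub>1..S\<^sub>2}"
    then have x': "x \<in> {0..S\<^sub>2}" using sub by auto
    show "((\<lambda>x. g\<^sub>2 x * f\<^sub>2 x) has_vector_derivative h\<^sub>2 x * f\<^sub>2 x + (g\<^sub>2 x)\<^sup>2) (at x within {S\<^sub>1..S\<^sub>2})"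
      unfolding has_real_derivative_iff_has_vector_derivative[symmetric]
      by (rule DERIV_cong[OF DERIV_mult[OF DERIV_subset[OF g2[OF x'] sub(2)]
            DERIV_subset[OF f2[OF x'] sub(2)]]]) (simp add: power2_eq_square)
  qed (use S in auto)
  let ?d = "\<lambda>x. h\<^sub>2 x * (f\<^sub>2 x - (if x \<le> S\<^sub>1 then f\<^sub>1 x else 0))"
  have i1: "((\<lambda>x. h\<^sub>2 x * (f\<^sub>2 x - f\<^sub>1 x)) has_integral integral {0..S\<^sub>1} (\<lambda>x. h\<^sub>2 x * (f\<^sub>2 x - f\<^sub>1 x))) {0..S\<^sub>1}"
    and i2: "((\<lambda>x. h\<^sub>2 x * f\<^sub>2 x) has_integral integral {S\<^sub>1..S\<^sub>2} (\<lambda>x. h\<^sub>2 x * f\<^sub>2 x)) {S\<^sub>1..S\<^sub>2}"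
    by (intro integrable_integral integrable_continuous_real continuous_intros cont)+
  have "(?d has_integral integral {0..S\<^sub>1} (\<lambda>x. h\<^sub>2 x * (f\<^sub>2 x - f\<^sub>1 x)) + integral {S\<^sub>1..S\<^sub>2} (\<lambda>x. h\<^sub>2 x * f\<^sub>2 x)) {0..S\<^sub>2}"
  proof (rule has_integral_combine[OF S])
    show "(?d has_integral integral {0..S\<^sub>1} (\<lambda>x. h\<^sub>2 x * (f\<^sub>2 x - f\<^sub>1 x))) {0..S\<^sub>1}"
      using i1 by (rule has_integral_eq[rotated]) simp
    show "(?d has_integral integral {S\<^sub>1..S\<^sub>2} (\<lambda>x. h\<^sub>2 x * f\<^sub>2 x)) {S\<^sub>1..S\<^sub>2}"
      using i2 by (rule has_integral_spike_finite[of "{S\<^sub>1}", rotated 2]) auto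
  qed
  then have d: "integral {0..S\<^sub>2} ?d = integral {0..S\<^sub>1} (\<lambda>x. h\<^sub>2 x * (f\<^sub>2 x - f\<^sub>1 x)) + integral {S\<^sub>1..S\<^sub>2} (\<lambda>x. h\<^sub>2 x * f\<^sub>2 x)"
    by (rule integral_unique)
  have sq: "integral {0..S\<^sub>2} (\<lambda>x. (g\<^sub>2 x)\<^sup>2) = integral {0..S\<^sub>1} (\<lambda>x. (g\<^sub>2 x)\<^sup>2) + integral {S\<^sub>1..S\<^sub>2} (\<lambda>x. (g\<^sub>2 x)\<^sup>2)"
    by (rule Henstock_Kurzweil_Integration.integral_combine[symmetric, OF S])
      (intro integrable_continuous_real continuous_intros cont)
  have "((\<lambda>x. h\<^sub>2 x * f\<^sub>2 x + (g\<^sub>2 x)\<^sup>2) has_integral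
     integral {S\<^sub>1..S\<^sub>2} (\<lambda>x. h\<^sub>2 x * f\<^sub>2 x) + integral {S\<^sub>1..S\<^sub>2} (\<lambda>x. (g\<^sub>2 x)\<^sup>2)) {S\<^sub>1..S\<^sub>2}"
    by (intro has_integral_add i2 integrable_integral integrable_continuous_real continuous_intros cont)
  from has_integral_unique[OF this B] bc
  have B': "integral {S\<^sub>1..S\<^sub>2} (\<lambda>x. h\<^sub>2 x * f\<^sub>2 x) + integral {S\<^sub>1..S\<^sub>2} (\<lambda>x. (g\<^sub>2 x)\<^sup>2) = - (g\<^sub>2 S\<^sub>1 * f\<^sub>2 S\<^sub>1)" by simp
  have "((\<lambda>x. h\<^sub>2 x * (f\<^sub>2 x - f\<^sub>1 x) + g\<^sub>2 x * (g\<^sub>2 x - g\<^sub>1 x)) has_integral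
     integral {0..S\<^sub>1} (\<lambda>x. h\<^sub>2 x * (f\<^sub>2 x - f\<^sub>1 x)) + integral {0..S\<^sub>1} (\<lambda>x. g\<^sub>2 x * (g\<^sub>2 x - g\<^sub>1 x))) {0..S\<^sub>1}"
    by (intro has_integral_add i1 integrable_integral integrable_continuous_real continuous_intros cont)
  from has_integral_unique[OF this A] bc
  have A': "integral {0..S\<^sub>1} (\<lambda>x. h\<^sub>2 x * (f\<^sub>2 x - f\<^sub>1 x)) + integral {0..S\<^sub>1} (\<lambda>x. g\<^sub>2 x * (g\<^sub>2 x - g\<^sub>1 x)) = g\<^sub>2 S\<^sub>1 * f\<^sub>2 S\<^sub>1" by simp
  have "((\<lambda>x. (g\<^sub>2 x)\<^sup>2 - (g\<^sub>1 x)\<^sup>2) has_integral integral {0..S\<^sub>1} (\<lambda>x. (g\<^sub>2 x)\<^sup>2) - integral {0..S\<^sub>1} (\<lambda>x. (g\<^sub>1 x)\<^sup>2)) {0..S\<^sub>1}"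
    by (intro has_integral_diff integrable_integral integrable_continuous_real continuous_intros cont)
  moreover have "((\<lambda>x. 2 * (g\<^sub>2 x * (g\<^sub>2 x - g\<^sub>1 x))) has_integral 2 * integral {0..S\<^sub>1} (\<lambda>x. g\<^sub>2 x * (g\<^sub>2 x - g\<^sub>1 x))) {0..S\<^sub>1}"
    by (intro has_integral_mult_right integrable_integral integrable_continuous_real continuous_intros cont)
  moreover have "(g\<^sub>2 x)\<^sup>2 - (g\<^sub>1 x)\<^sup>2 \<le> 2 * (g\<^sub>2 x * (g\<^sub>2 x - g\<^sub>1 x))" for x
    using zero_le_power2[of "g\<^sub>2 x - g\<^sub>1 x"] by (simp add: power2_eq_square algebra_simps)
  ultimately have "integral {0..S\<^sub>1} (\<lambda>x. (g\<^sub>2 x)\<^sup>2) - integral {0..S\<^sub>1} (\<lambda>x. (g\<^sub>1 x)\<^sup>2) \<le> 2 * integral {0..S\<^sub>1} (\<lambda>x. g\<^sub>2 x * (g\<^sub>2 x - g\<^sub>1 x))"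
    by (rule has_integral_le)
  moreover have "0 \<le> integral {S\<^sub>1..S\<^sub>2} (\<lambda>x. (g\<^sub>2 x)\<^sup>2)"
    by (rule integral_nonneg) (auto intro!: integrable_continuous_real continuous_intros cont)
  moreover have "a + r - b \<le> - 2 * (j + k)"
    if "a - b \<le> 2 * i" "0 \<le> r" "j + i = p" "k + r = - p" for a b i j k r p :: real
  proof -
    have "j + k = - i - r" using that(3,4) by linarith
    then have "- 2 * (j + k) = 2 * i + 2 * r" by simp
    with that(1,2) show ?thesis by linarith
  qed
  ultimately show ?thesis unfolding d sq using A' B' by blast
qed

text \<open>One integration by parts without boundary terms shows that the right-hand side is
  \<alpha> times the integral of h^2 plus lam times the integral of g^2; the first summand is
  dropped. As E' is formally -2 times the right-hand side, the decay rate 2 lam originates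
  here.\<close>

lemma energy_dissipation:
  fixes f g h :: "real \<Rightarrow> real"
  assumes "0 \<le> S" "0 \<le> \<alpha>"
    and f: "\<And>x. x \<in> {0..S} \<Longrightarrow> (f has_real_derivative g x) (at x within {0..S})"
    and g: "\<And>x. x \<in> {0..S} \<Longrightarrow> (g has_real_derivative h x) (at x within {0..S})"
    and h: "continuous_on {0..S} h"
    and bc: "f S = 0" "g 0 = 0"
  shows "lam * integral {0..S} (\<lambda>x. (g x)\<^sup>2) \<le> integral {0..S} (\<lambda>x. h x * (\<alpha> * h x - lam * f x))"
proof -
  have cont: "continuous_on {0..S} f" "continuous_on {0..S} g" "continuous_on {0..S} h"
    using DERIV_continuous_on f g h by blast+
  have "((\<lambda>x. h x * f x + (g x)\<^sup>2) has_integral g S * f S - g 0 * f 0) {0..S}"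
  proof (rule fundamental_theorem_of_calculus)
    fix x assume x: "x \<in> {0..S}"
    show "((\<lambda>x. g x * f x) has_vector_derivative h x * f x + (g x)\<^sup>2) (at x within {0..S})"
      unfolding has_real_derivative_iff_has_vector_derivative[symmetric]
      by (rule DERIV_cong[OF DERIV_mult[OF g[OF x] f[OF x]]]) (simp add: power2_eq_square)
  qed (use assms in auto)
  moreover have "((\<lambda>x. h x * f x + (g x)\<^sup>2) has_integral
     integral {0..S} (\<lambda>x. h x * f x) + integral {0..S} (\<lambda>x. (g x)\<^sup>2)) {0..S}"
    by (intro has_integral_add integrable_integral integrable_continuous_real continuous_intros cont)
  ultimately have 1: "integral {0..S} (\<lambda>x. h x * f x) = - integral {0..S} (\<lambda>x. (g x)\<^sup>2)"
    using bc by (auto dest: has_integral_unique)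
  have "((\<lambda>x. \<alpha> * (h x)\<^sup>2 - lam * (h x * f x)) has_integral
     \<alpha> * integral {0..S} (\<lambda>x. (h x)\<^sup>2) - lam * integral {0..S} (\<lambda>x. h x * f x)) {0..S}"
    by (intro has_integral_diff has_integral_mult_right integrable_integral integrable_continuous_real continuous_intros cont)
  then have "integral {0..S} (\<lambda>x. h x * (\<alpha> * h x - lam * f x)) =
     \<alpha> * integral {0..S} (\<lambda>x. (h x)\<^sup>2) - lam * integral {0..S} (\<lambda>x. h x * f x)"
    by (subst integral_unique[symmetric]) (auto simp: power2_eq_square algebra_simps)
  moreover have "0 \<le> integral {0..S} (\<lambda>x. (h x)\<^sup>2)"
    by (rule integral_nonneg) (auto intro!: integrable_continuous_real continuous_intros cont)
  ultimately show ?thesis using 1 \<open>0 \<le> \<alpha>\<close> by simp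
qed

section \<open>Equivalence of the H1 norm and the energy, uniformly for S \<le> L\<close>

text \<open>The square of g - m has nonnegative integral; m is taken as the mean of g, which makes
  this the sharp choice.\<close>

lemma Cauchy_Schwarz_integral_1:
  fixes g :: "real \<Rightarrow> real"
  assumes "g integrable_on {0..S}" "(\<lambda>x. (g x)\<^sup>2) integrable_on {0..S}" "0 < S"
  shows "(integral {0..S} g)\<^sup>2 \<le> S * integral {0..S} (\<lambda>x. (g x)\<^sup>2)"
proof -
  define m where "m = integral {0..S} g / S"
  have "((\<lambda>x. (g x)\<^sup>2 - 2 * m * g x + m\<^sup>2) has_integral
     integral {0..S} (\<lambda>x. (g x)\<^sup>2) - 2 * m * integral {0..S} g + m\<^sup>2 * (S - 0)) {0..S}"
    using assms has_integral_const_real[of "m\<^sup>2" 0 S]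
    by (intro has_integral_add has_integral_diff has_integral_mult_right integrable_integral)
       (auto simp: mult.commute)
  moreover have "0 \<le> (g x)\<^sup>2 - 2 * m * g x + m\<^sup>2" for x
    using zero_le_power2[of "g x - m"] by (simp add: power2_diff mult_ac)
  ultimately have "0 \<le> integral {0..S} (\<lambda>x. (g x)\<^sup>2) - 2 * m * integral {0..S} g + m\<^sup>2 * (S - 0)"
    by (rule has_integral_nonneg)
  moreover have "integral {0..S} g = m * S" using assms by (simp add: m_def)
  ultimately have "m\<^sup>2 * S \<le> integral {0..S} (\<lambda>x. (g x)\<^sup>2)" by (simp add: power2_eq_square algebra_simps)
  then have "S * (m\<^sup>2 * S) \<le> S * integral {0..S} (\<lambda>x. (g x)\<^sup>2)"
    using assms by (intro mult_left_mono) auto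
  then show ?thesis unfolding \<open>integral {0..S} g = m * S\<close> by (simp add: power2_eq_square algebra_simps)
qed

text \<open>Compactness of the square gives one bound for all fronts below L. Since K depends on c
  and L alone, so do the equivalence constants built from it, which keeps them independent of the
  solution.\<close>

lemma kernel_bound:
  obtains K where "0 < K"
    and "\<And>x y. x \<in> {0..L} \<Longrightarrow> y \<in> {0..L} \<Longrightarrow> \<bar>ker c x y\<bar> \<le> K \<and> \<bar>ker_x c x y\<bar> \<le> K"
    and "\<And>x. x \<in> {0..L} \<Longrightarrow> \<bar>c * x / 2\<bar> \<le> K"
proof -
  have "compact (f ` ({0..L} \<times> {0..L}))" if "continuous_on UNIV f" for f :: "real \<times> real \<Rightarrow> real"
    using that by (intro compact_continuous_image compact_Times) (auto elim: continuous_on_subset)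
  then have *: "\<exists>B. \<forall>z\<in>{0..L} \<times> {0..L}. \<bar>f z\<bar> \<le> B" if "continuous_on UNIV f" for f :: "real \<times> real \<Rightarrow> real"
    using compact_imp_bounded[of "f ` ({0..L} \<times> {0..L})"] that unfolding bounded_iff by fastforce
  obtain A B where A: "\<And>z. z \<in> {0..L} \<times> {0..L} \<Longrightarrow> \<bar>case z of (x, y) \<Rightarrow> ker c x y\<bar> \<le> A"
    and B: "\<And>z. z \<in> {0..L} \<times> {0..L} \<Longrightarrow> \<bar>case z of (x, y) \<Rightarrow> ker_x c x y\<bar> \<le> B"
    using *[OF continuous_on_ker_pair(1)] *[OF continuous_on_ker_pair(2)] by meson
  show ?thesis
  proof (rule that[of "\<bar>A\<bar> + \<bar>B\<bar> + \<bar>c\<bar> * \<bar>L\<bar> / 2 + 1"])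
    show "0 < \<bar>A\<bar> + \<bar>B\<bar> + \<bar>c\<bar> * \<bar>L\<bar> / 2 + 1" by (intro add_nonneg_pos) auto
    have nn: "0 \<le> \<bar>c\<bar> * \<bar>L\<bar> / 2" by simp
    fix x assume x: "x \<in> {0..L}"
    then have "\<bar>c\<bar> * \<bar>x\<bar> \<le> \<bar>c\<bar> * \<bar>L\<bar>" by (intro mult_left_mono) auto
    moreover have "\<bar>c * x / 2\<bar> = \<bar>c\<bar> * \<bar>x\<bar> / 2" by (simp add: abs_mult)
    ultimately show "\<bar>c * x / 2\<bar> \<le> \<bar>A\<bar> + \<bar>B\<bar> + \<bar>c\<bar> * \<bar>L\<bar> / 2 + 1" by linarith
    fix y assume "y \<in> {0..L}"
    then have "\<bar>ker c x y\<bar> \<le> A" "\<bar>ker_x c x y\<bar> \<le> B" using x A[of "(x, y)"] B[of "(x, y)"] by auto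
    with nn abs_ge_self[of A] abs_ge_self[of B] abs_ge_zero[of A] abs_ge_zero[of B]
    show "\<bar>ker c x y\<bar> \<le> \<bar>A\<bar> + \<bar>B\<bar> + \<bar>c\<bar> * \<bar>L\<bar> / 2 + 1 \<and> \<bar>ker_x c x y\<bar> \<le> \<bar>A\<bar> + \<bar>B\<bar> + \<bar>c\<bar> * \<bar>L\<bar> / 2 + 1"
      by linarith
  qed
qed

lemma abs_integral_le:
  fixes f g :: "real \<Rightarrow> real"
  assumes "f integrable_on S" "g integrable_on S" "\<And>x. x \<in> S \<Longrightarrow> \<bar>f x\<bar> \<le> g x"
  shows "\<bar>integral S f\<bar> \<le> integral S g"
  using integral_norm_bound_integral[OF assms(1,2)] assms(3) by auto

text \<open>Taking the maximum \<open>m\<close> of \<open>\<bar>v x\<bar> exp (2 K x)\<close> absorbs the integral term, as in Gronwall's lemma.\<close>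

lemma Volterra_sup_bound:
  fixes v :: "real \<Rightarrow> real"
  assumes "0 \<le> S" "0 < K" and v: "continuous_on {0..S} v"
    and le: "\<And>x. x \<in> {0..S} \<Longrightarrow> \<bar>v x\<bar> \<le> W + K * integral {x..S} (\<lambda>y. \<bar>v y\<bar>)"
    and x: "x \<in> {0..S}"
  shows "\<bar>v x\<bar> \<le> 2 * W * exp (2 * K * S)"
proof -
  have "continuous_on {0..S} (\<lambda>x. \<bar>v x\<bar> * exp (2 * K * x))"
    by (intro continuous_intros v)
  from continuous_attains_sup[OF compact_Icc _ this] \<open>0 \<le> S\<close>
  obtain z where z: "z \<in> {0..S}"
    and max: "\<And>y. y \<in> {0..S} \<Longrightarrow> \<bar>v y\<bar> * exp (2 * K * y) \<le> \<bar>v z\<bar> * exp (2 * K * z)"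
    by auto
  define m where "m = \<bar>v z\<bar> * exp (2 * K * z)"
  have vy: "\<bar>v y\<bar> \<le> m * exp (- (2 * K) * y)" if "y \<in> {0..S}" for y
    using max[OF that] by (simp add: m_def exp_minus field_simps)
  have "((\<lambda>y. m * exp (- (2 * K) * y)) has_integral
      (- m / (2 * K) * exp (- (2 * K) * S)) - (- m / (2 * K) * exp (- (2 * K) * z))) {z..S}"
  proof (rule fundamental_theorem_of_calculus)
    fix y
    have "((\<lambda>y. exp (- (2 * K) * y)) has_real_derivative exp (- (2 * K) * y) * (- (2 * K))) (at y within {z..S})"
      by (auto intro!: derivative_eq_intros)
    from DERIV_cmult[OF this, of "- m / (2 * K)"]
    show "((\<lambda>y. - m / (2 * K) * exp (- (2 * K) * y)) has_vector_derivative m * exp (- (2 * K) * y)) (at y within {z..S})"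
      unfolding has_real_derivative_iff_has_vector_derivative[symmetric]
      by (rule DERIV_cong) (use \<open>0 < K\<close> in simp)
  qed (use z in auto)
  note J = this
  have I: "((\<lambda>y. \<bar>v y\<bar>) has_integral integral {z..S} (\<lambda>y. \<bar>v y\<bar>)) {z..S}"
    using z by (intro integrable_integral integrable_continuous_real continuous_intros continuous_on_subset[OF v]) auto
  have "integral {z..S} (\<lambda>y. \<bar>v y\<bar>) \<le> - m / (2 * K) * exp (- (2 * K) * S) - (- m / (2 * K) * exp (- (2 * K) * z))"
    by (rule has_integral_le[OF I J], rule vy) (use z in auto)
  also have "\<dots> \<le> m / (2 * K) * exp (- (2 * K) * z)"
    using \<open>0 < K\<close> by (simp add: m_def)
  finally have "K * integral {z..S} (\<lambda>y. \<bar>v y\<bar>) \<le> K * (m / (2 * K) * exp (- (2 * K) * z))"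
    using \<open>0 < K\<close> by (intro mult_left_mono) auto
  \<comment> \<open>The rate 2 K of the weight is chosen so that the integral term takes at most
    half of the left-hand side at the maximum point; absorbing it doubles W.\<close>
  also have "\<dots> = \<bar>v z\<bar> / 2" using \<open>0 < K\<close> by (simp add: m_def exp_minus)
  finally have vz: "\<bar>v z\<bar> \<le> 2 * W" using le[OF z] by linarith
  have "m \<le> 2 * W * exp (2 * K * S)"
    unfolding m_def using vz z \<open>0 < K\<close> by (intro mult_mono) auto
  moreover have "m * exp (- (2 * K) * x) \<le> m * 1"
    using x \<open>0 < K\<close> by (intro mult_left_mono) (auto simp: m_def)
  ultimately show ?thesis using vy[OF x] by linarith
qed

lemma square_add3_le: "(a + b + c)\<^sup>2 \<le> 3 * (a\<^sup>2 + b\<^sup>2 + c\<^sup>2)" for a b c :: real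
  using zero_le_power2[of "a - b"] zero_le_power2[of "b - c"] zero_le_power2[of "a - c"]
  by (simp add: power2_eq_square algebra_simps)

text \<open>Since v, and hence w, vanishes at S, integrating w_x from S bounds w uniformly by W =
  sqrt(L E). Read as a Volterra equation for v, the transformation then bounds v uniformly, and the
  formula for \<open>bstep_x\<close>, solved for v', bounds v' by w_x and the bound on v.\<close>

lemma H1_le_energy:
  assumes "0 < L"
  obtains C where "0 < C"
    and "\<And>S v v'. 0 < S \<Longrightarrow> S \<le> L \<Longrightarrow> v S = 0 \<Longrightarrow> continuous_on {0..S} v' \<Longrightarrow>
        (\<And>x. x \<in> {0..S} \<Longrightarrow> (v has_real_derivative v' x) (at x within {0..S})) \<Longrightarrow>
        integral {0..S} (\<lambda>x. (v x)\<^sup>2) + integral {0..S} (\<lambda>x. (v' x)\<^sup>2)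
          \<le> C * integral {0..S} (\<lambda>x. (bstep_x c S v v' x)\<^sup>2)"
proof -
  obtain K where K: "0 < K"
    and ker: "\<And>x y. x \<in> {0..L} \<Longrightarrow> y \<in> {0..L} \<Longrightarrow> \<bar>ker c x y\<bar> \<le> K \<and> \<bar>ker_x c x y\<bar> \<le> K"
    and cx: "\<And>x. x \<in> {0..L} \<Longrightarrow> \<bar>c * x / 2\<bar> \<le> K"
    by (rule kernel_bound[of L c]) blast
  \<comment> \<open>\<open>A * E\<close> will bound v^2 pointwise: it is the square of
    \<open>m = 2 * W * exp (2 * K * L)\<close> with W^2 = L E.\<close>
  define A where "A = (2 * exp (2 * K * L))\<^sup>2 * L"
  have A: "0 < A" using assms by (simp add: A_def)
  \<comment> \<open>The 1 comes from v^2 and the terms with 3 from splitting v' into three summands,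
    bounded by w_x, K m and K m L; integrating the constant part over an interval of length at most
    L gives the last factor.\<close>
  define C where "C = 3 + A * (1 + 3 * K\<^sup>2 + 3 * K\<^sup>2 * L\<^sup>2) * L"
  have "0 < C" using A K assms unfolding C_def by (intro add_pos_nonneg mult_nonneg_nonneg add_nonneg_nonneg) auto
  moreover have "integral {0..S} (\<lambda>x. (v x)\<^sup>2) + integral {0..S} (\<lambda>x. (v' x)\<^sup>2)
          \<le> C * integral {0..S} (\<lambda>x. (bstep_x c S v v' x)\<^sup>2)"
    if S: "0 < S" "S \<le> L" and vS: "v S = 0" and v': "continuous_on {0..S} v'"
      and D: "\<And>x. x \<in> {0..S} \<Longrightarrow> (v has_real_derivative v' x) (at x within {0..S})" for S v v'
  proof -
    have v: "continuous_on {0..S} v" by (rule DERIV_continuous_on) (rule D)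
    let ?w = "bstep c S v" and ?g = "bstep_x c S v v'"
    have Dw: "(?w has_real_derivative ?g x) (at x within {0..S})" if "x \<in> {0..S}" for x
      by (rule DERIV_bstep[where v' = v', OF v that D[OF that]])
    have g: "continuous_on {0..S} ?g"
    proof -
      have "continuous_on {0..S} (\<lambda>x. integral {x..S} (\<lambda>y. ker_x c x y * v y))"
        by (rule DERIV_continuous_on)
          (rule DERIV_integral_lower[OF DERIV_ker(2) continuous_on_ker_pair(2,3) v])
      then show ?thesis unfolding bstep_x_def[abs_def] by (intro continuous_intros v v') auto
    qed
    define E where "E = integral {0..S} (\<lambda>x. (?g x)\<^sup>2)"
    have E: "0 \<le> E" unfolding E_def
      by (rule integral_nonneg) (auto intro!: integrable_continuous_real continuous_intros g)
    define W where "W = sqrt (L * E)"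
    have I: "integral {0..S} (\<lambda>x. \<bar>?g x\<bar>) \<le> W"
    proof -
      have "(integral {0..S} (\<lambda>x. \<bar>?g x\<bar>))\<^sup>2 \<le> S * integral {0..S} (\<lambda>x. \<bar>?g x\<bar>\<^sup>2)"
        by (rule Cauchy_Schwarz_integral_1)
          (auto intro!: integrable_continuous_real continuous_intros g S simp del: power2_abs)
      also have "\<dots> \<le> L * E"
        using S E by (simp add: E_def[symmetric] mult_right_mono)
      finally show ?thesis unfolding W_def by (rule real_le_rsqrt)
    qed
    have w: "\<bar>?w x\<bar> \<le> W" if x: "x \<in> {0..S}" for x
    proof -
      have gx: "continuous_on {x..S} ?g" using g x by (auto elim: continuous_on_subset)
      have "(?g has_integral ?w S - ?w x) {x..S}"
        by (rule fundamental_theorem_of_calculus)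
          (use x in \<open>auto simp: has_real_derivative_iff_has_vector_derivative[symmetric] intro!: DERIV_subset[OF Dw]\<close>)
      then have "?w x = - integral {x..S} ?g" using vS by (simp add: integral_unique)
      then have "\<bar>?w x\<bar> \<le> integral {x..S} (\<lambda>x. \<bar>?g x\<bar>)"
        using abs_integral_le[of ?g "{x..S}" "\<lambda>x. \<bar>?g x\<bar>"] gx
        by (auto intro!: integrable_continuous_real continuous_intros)
      also have "\<dots> \<le> integral {0..S} (\<lambda>x. \<bar>?g x\<bar>)"
        using x by (intro integral_subset_le) (auto intro!: integrable_continuous_real continuous_intros g gx)
      finally show ?thesis using I by linarith
    qed
    have kint: "\<bar>integral {x..S} (\<lambda>y. k y * v y)\<bar> \<le> K * integral {x..S} (\<lambda>y. \<bar>v y\<bar>)"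
      if x: "x \<in> {0..S}" and k: "continuous_on {x..S} k" "\<And>y. y \<in> {0..L} \<Longrightarrow> \<bar>k y\<bar> \<le> K" for x k
    proof -
      have vx: "continuous_on {x..S} v" using v x by (auto elim: continuous_on_subset)
      have "\<bar>integral {x..S} (\<lambda>y. k y * v y)\<bar> \<le> integral {x..S} (\<lambda>y. K * \<bar>v y\<bar>)"
        using x S by (intro abs_integral_le integrable_continuous_real continuous_intros vx k)
          (auto simp: abs_mult intro!: mult_right_mono k)
      then show ?thesis by simp
    qed
    define m where "m = 2 * W * exp (2 * K * L)"
    have vm: "\<bar>v x\<bar> \<le> m" if "x \<in> {0..S}" for x
    proof -
      have "\<bar>v x\<bar> \<le> 2 * W * exp (2 * K * S)"
      proof (rule Volterra_sup_bound[OF _ K v _ that])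
        fix x assume x: "x \<in> {0..S}"
        have "v x = ?w x + integral {x..S} (\<lambda>y. ker c x y * v y)" by (simp add: bstep_def)
        moreover have "\<bar>integral {x..S} (\<lambda>y. ker c x y * v y)\<bar> \<le> K * integral {x..S} (\<lambda>y. \<bar>v y\<bar>)"
          using x S ker[of x] by (intro kint continuous_intros) auto
        ultimately show "\<bar>v x\<bar> \<le> W + K * integral {x..S} (\<lambda>y. \<bar>v y\<bar>)"
          using w[OF x] by linarith
      qed (use S in auto)
      also have "\<dots> \<le> m" unfolding m_def using S K E assms
        by (intro mult_left_mono) (auto simp: W_def)
      finally show ?thesis .
    qed
    have "m\<^sup>2 = A * E" using E assms by (simp add: m_def W_def A_def power_mult_distrib)
    have v2: "(v x)\<^sup>2 \<le> A * E" if "x \<in> {0..S}" for x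
      unfolding \<open>m\<^sup>2 = A * E\<close>[symmetric] using vm[OF that] by (simp add: abs_le_square_iff[symmetric])
    have "(v x)\<^sup>2 + (v' x)\<^sup>2 \<le> A * E * (1 + 3 * K\<^sup>2 + 3 * K\<^sup>2 * L\<^sup>2) + 3 * (?g x)\<^sup>2"
      if x: "x \<in> {0..S}" for x
    proof -
      let ?a = "- (c * x / 2 * v x)" and ?b = "integral {x..S} (\<lambda>y. ker_x c x y * v y)"
      have m0: "0 \<le> m" using vm[OF x] by linarith
      have "\<bar>?a\<bar> \<le> K * m" using cx[of x] vm[OF x] x S K
        by (simp only: abs_minus abs_mult) (intro mult_mono, auto)
      then have a: "?a\<^sup>2 \<le> (K * m)\<^sup>2" using K m0 by (simp add: abs_le_square_iff[symmetric])
      have "\<bar>?b\<bar> \<le> K * integral {x..S} (\<lambda>y. \<bar>v y\<bar>)"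
        using x S ker[of x] by (intro kint continuous_intros) auto
      also have "\<dots> \<le> K * (m * L)"
      proof (intro mult_left_mono)
        have "integral {x..S} (\<lambda>y. \<bar>v y\<bar>) \<le> integral {x..S} (\<lambda>y. m)"
          using x vm by (intro integral_le integrable_continuous_real continuous_intros continuous_on_subset[OF v]) auto
        also have "\<dots> = m * (S - x)" using x by simp
        also have "\<dots> \<le> m * L" using x S m0 by (intro mult_left_mono) auto
        finally show "integral {x..S} (\<lambda>y. \<bar>v y\<bar>) \<le> m * L" .
      qed (use K in auto)
      finally have b: "?b\<^sup>2 \<le> (K * (m * L))\<^sup>2" using K m0 assms by (simp add: abs_le_square_iff[symmetric])
      have "v' x = ?g x + ?a + ?b" by (simp add: bstep_x_def)
      then have "(v' x)\<^sup>2 \<le> 3 * ((?g x)\<^sup>2 + ?a\<^sup>2 + ?b\<^sup>2)" by (simp only: square_add3_le)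
      also have "\<dots> \<le> 3 * ((?g x)\<^sup>2 + (K * m)\<^sup>2 + (K * (m * L))\<^sup>2)" using a b by simp
      also have "\<dots> = 3 * (?g x)\<^sup>2 + m\<^sup>2 * (3 * K\<^sup>2 + 3 * K\<^sup>2 * L\<^sup>2)" by (simp add: power_mult_distrib algebra_simps)
      finally show ?thesis using v2[OF x] unfolding \<open>m\<^sup>2 = A * E\<close> by (simp add: algebra_simps)
    qed
    moreover have "((\<lambda>x. (v x)\<^sup>2 + (v' x)\<^sup>2) has_integral
       integral {0..S} (\<lambda>x. (v x)\<^sup>2) + integral {0..S} (\<lambda>x. (v' x)\<^sup>2)) {0..S}"
      by (intro has_integral_add integrable_integral integrable_continuous_real continuous_intros v v')
    moreover have "((\<lambda>x. A * E * (1 + 3 * K\<^sup>2 + 3 * K\<^sup>2 * L\<^sup>2) + 3 * (?g x)\<^sup>2) has_integral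
        A * E * (1 + 3 * K\<^sup>2 + 3 * K\<^sup>2 * L\<^sup>2) * S + 3 * E) {0..S}"
      unfolding E_def
      using has_integral_const_real[of "A * E * (1 + 3 * K\<^sup>2 + 3 * K\<^sup>2 * L\<^sup>2)" 0 S] S
      by (intro has_integral_add has_integral_mult_right integrable_integral integrable_continuous_real continuous_intros g)
        (simp add: mult.commute E_def)
    ultimately have "integral {0..S} (\<lambda>x. (v x)\<^sup>2) + integral {0..S} (\<lambda>x. (v' x)\<^sup>2)
        \<le> A * E * (1 + 3 * K\<^sup>2 + 3 * K\<^sup>2 * L\<^sup>2) * S + 3 * E"
      by (metis (no_types, lifting) has_integral_le)
    also have "\<dots> \<le> A * E * (1 + 3 * K\<^sup>2 + 3 * K\<^sup>2 * L\<^sup>2) * L + 3 * E"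
      using S A E by (intro add_right_mono mult_left_mono mult_nonneg_nonneg) auto
    also have "\<dots> = C * E" by (simp add: C_def algebra_simps)
    finally show ?thesis by (simp add: E_def)
  qed
  ultimately show ?thesis by (rule that)
qed

text \<open>The formula for \<open>bstep_x\<close> bounds w_x directly by v', v and an integral of
  v. It is applied at the initial time, hence v' is tied to v by no derivative condition and only
  the squares are assumed integrable.\<close>

lemma energy_le_H1:
  assumes "0 < L"
  obtains C where "0 < C"
    and "\<And>S v v'. 0 < S \<Longrightarrow> S \<le> L \<Longrightarrow> continuous_on {0..S} v \<Longrightarrow>
        (\<lambda>x. (v' x)\<^sup>2) integrable_on {0..S} \<Longrightarrow>
        (\<lambda>x. (bstep_x c S v v' x)\<^sup>2) integrable_on {0..S} \<Longrightarrow>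
        integral {0..S} (\<lambda>x. (bstep_x c S v v' x)\<^sup>2)
          \<le> C * (integral {0..S} (\<lambda>x. (v x)\<^sup>2) + integral {0..S} (\<lambda>x. (v' x)\<^sup>2))"
proof -
  obtain K where K: "0 < K"
    and ker: "\<And>x y. x \<in> {0..L} \<Longrightarrow> y \<in> {0..L} \<Longrightarrow> \<bar>ker c x y\<bar> \<le> K \<and> \<bar>ker_x c x y\<bar> \<le> K"
    and cx: "\<And>x. x \<in> {0..L} \<Longrightarrow> \<bar>c * x / 2\<bar> \<le> K"
    by (rule kernel_bound[of L c]) blast
  define C where "C = 3 + 3 * K\<^sup>2 + 3 * K\<^sup>2 * L\<^sup>2"
  have "0 < C" unfolding C_def by (intro add_pos_nonneg) auto
  moreover have "integral {0..S} (\<lambda>x. (bstep_x c S v v' x)\<^sup>2)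
          \<le> C * (integral {0..S} (\<lambda>x. (v x)\<^sup>2) + integral {0..S} (\<lambda>x. (v' x)\<^sup>2))"
    if S: "0 < S" "S \<le> L" and v: "continuous_on {0..S} v" and v': "(\<lambda>x. (v' x)\<^sup>2) integrable_on {0..S}"
      and g: "(\<lambda>x. (bstep_x c S v v' x)\<^sup>2) integrable_on {0..S}" for S v v'
  proof -
    define V where "V = integral {0..S} (\<lambda>x. (v x)\<^sup>2)"
    define V' where "V' = integral {0..S} (\<lambda>x. (v' x)\<^sup>2)"
    have v2: "(\<lambda>x. (v x)\<^sup>2) integrable_on {0..S}"
      by (intro integrable_continuous_real continuous_intros v)
    have V: "0 \<le> V" "0 \<le> V'" unfolding V_def V'_def by (intro integral_nonneg v2 v'; simp)+
    have "(bstep_x c S v v' x)\<^sup>2 \<le> 3 * (v' x)\<^sup>2 + 3 * K\<^sup>2 * (v x)\<^sup>2 + 3 * K\<^sup>2 * L * V"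
      if x: "x \<in> {0..S}" for x
    proof -
      let ?b = "integral {x..S} (\<lambda>y. ker_x c x y * v y)"
      have vx: "continuous_on {x..S} v" using v x by (auto elim: continuous_on_subset)
      have "(c * x / 2)\<^sup>2 \<le> K\<^sup>2" using cx[of x] x S K by (simp add: abs_le_square_iff[symmetric])
      then have a: "(c * x / 2 * v x)\<^sup>2 \<le> K\<^sup>2 * (v x)\<^sup>2"
        unfolding power_mult_distrib[of _ "v x"] by (intro mult_right_mono) auto
      have "\<bar>?b\<bar> \<le> integral {x..S} (\<lambda>y. K * \<bar>v y\<bar>)"
        using x S ker by (intro abs_integral_le integrable_continuous_real continuous_intros vx)
          (auto simp: abs_mult intro!: mult_right_mono)
      also have "\<dots> \<le> integral {0..S} (\<lambda>y. K * \<bar>v y\<bar>)"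
        using x K by (intro integral_subset_le) (auto intro!: integrable_continuous_real continuous_intros v vx)
      finally have "\<bar>?b\<bar> \<le> \<bar>K * integral {0..S} (\<lambda>y. \<bar>v y\<bar>)\<bar>" by simp
      then have "?b\<^sup>2 \<le> (K * integral {0..S} (\<lambda>y. \<bar>v y\<bar>))\<^sup>2" by (simp only: abs_le_square_iff)
      also have "\<dots> \<le> K\<^sup>2 * (S * integral {0..S} (\<lambda>y. \<bar>v y\<bar>\<^sup>2))"
        unfolding power_mult_distrib using S
        by (intro mult_left_mono Cauchy_Schwarz_integral_1 integrable_continuous_real continuous_intros v) auto
      also have "\<dots> \<le> K\<^sup>2 * (L * V)"
        using S V by (auto simp: V_def intro!: mult_left_mono mult_right_mono)
      finally have b: "?b\<^sup>2 \<le> K\<^sup>2 * (L * V)" .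
      have "(bstep_x c S v v' x)\<^sup>2 \<le> 3 * ((v' x)\<^sup>2 + (c * x / 2 * v x)\<^sup>2 + (- ?b)\<^sup>2)"
        using square_add3_le[of "v' x" "c * x / 2 * v x" "- ?b"] by (simp add: bstep_x_def)
      with a b show ?thesis by (simp add: algebra_simps)
    qed
    moreover have "((\<lambda>x. 3 * (v' x)\<^sup>2 + 3 * K\<^sup>2 * (v x)\<^sup>2 + 3 * K\<^sup>2 * L * V) has_integral
       3 * V' + 3 * K\<^sup>2 * V + 3 * K\<^sup>2 * L * V * S) {0..S}"
      unfolding V_def V'_def
      using has_integral_const_real[of "3 * K\<^sup>2 * L * V" 0 S] S
      by (intro has_integral_add has_integral_mult_right integrable_integral v2 v')
        (simp add: V_def mult_ac)
    ultimately have I: "integral {0..S} (\<lambda>x. (bstep_x c S v v' x)\<^sup>2) \<le> 3 * V' + 3 * K\<^sup>2 * V + 3 * K\<^sup>2 * L * V * S"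
      using integrable_integral[OF g] by (metis (no_types, lifting) has_integral_le)
    also have "\<dots> \<le> 3 * V' + 3 * K\<^sup>2 * V + 3 * K\<^sup>2 * L * V * L"
      using S V assms by (intro add_left_mono mult_left_mono mult_nonneg_nonneg) auto
    also have "\<dots> \<le> C * (V + V')"
    proof -
      have "C * (V + V') - (3 * V' + 3 * K\<^sup>2 * V + 3 * K\<^sup>2 * L * V * L) = 3 * V + 3 * K\<^sup>2 * V' + 3 * K\<^sup>2 * L\<^sup>2 * V'"
        by (simp add: C_def power2_eq_square algebra_simps)
      moreover have "0 \<le> 3 * V + 3 * K\<^sup>2 * V' + 3 * K\<^sup>2 * L\<^sup>2 * V'" using V by auto
      ultimately show ?thesis by linarith
    qed
    finally show ?thesis by (simp add: V_def V'_def)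
  qed
  ultimately show ?thesis by (rule that)
qed

section \<open>Decay from a bound on backward differences\<close>

text \<open>Comparison with a strict supersolution \<psi>. At the first time where E reaches \<psi>,
  all earlier values of E lie below \<psi>, so the backward differences of E are at least those of
  \<psi>, against the hypothesis. Only times before t enter, so a bound on the left is
  enough.\<close>

lemma Dini_decay:
  fixes E :: "real \<Rightarrow> real"
  assumes "0 < \<mu>" and E: "continuous_on {0..} E"
    and dini: "\<And>t e. 0 < t \<Longrightarrow> 0 < e \<Longrightarrow> \<forall>\<^sub>F \<tau> in at_left t. E t - E \<tau> \<le> (t - \<tau>) * (- \<mu> * E t + e)"
    and "0 \<le> T"
  shows "E T \<le> E 0 * exp (- \<mu> * T)"
proof (rule field_le_epsilon)
  fix e :: real assume "0 < e"
  \<comment> \<open>This makes the perturbation of \<psi> at time T exactly e.\<close>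
  define \<epsilon> where "\<epsilon> = e / (1 + T)"
  have \<epsilon>: "0 < \<epsilon>" using \<open>0 < e\<close> \<open>0 \<le> T\<close> by (simp add: \<epsilon>_def)
  \<comment> \<open>The perturbation puts \<psi> strictly above E at time 0 and gives \<psi>' > -
    \<mu> \<psi> + \<epsilon> / 2; the slack \<epsilon> / 2 is spent on the error allowed in the
    hypothesis.\<close>
  define \<psi> where "\<psi> = (\<lambda>t. E 0 * exp (- \<mu> * t) + \<epsilon> * (1 + t))"
  have cont\<psi>: "continuous_on X \<psi>" for X unfolding \<psi>_def by (intro continuous_intros)
  have "E T \<le> \<psi> T"
  proof (rule ccontr)
    assume "\<not> E T \<le> \<psi> T"
    define A where "A = {t \<in> {0..T}. \<psi> t \<le> E t}"
    have "closed A" unfolding A_def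
      by (intro continuous_on_closed_Collect_le cont\<psi> continuous_on_subset[OF E]) auto
    moreover have "bounded A" by (rule bounded_subset[OF bounded_closed_interval[of 0 T]]) (auto simp: A_def)
    ultimately have "compact A" by (simp add: compact_eq_bounded_closed)
    have "T \<in> A" using \<open>\<not> E T \<le> \<psi> T\<close> \<open>0 \<le> T\<close> by (simp add: A_def)
    with compact_attains_inf[OF \<open>compact A\<close>] obtain t where t: "t \<in> A" "\<And>\<tau>. \<tau> \<in> A \<Longrightarrow> t \<le> \<tau>" by blast
    have "0 \<notin> A" using \<epsilon> by (simp add: A_def \<psi>_def)
    with t have "0 < t" "\<psi> t \<le> E t" "t \<le> T" by (auto simp: A_def order.order_iff_strict)
    have D: "(\<psi> has_real_derivative - \<mu> * (E 0 * exp (- \<mu> * t)) + \<epsilon>) (at t within {..<t})"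
      unfolding \<psi>_def by (auto intro!: derivative_eq_intros)
    then have "((\<lambda>\<tau>. (\<psi> \<tau> - \<psi> t) / (\<tau> - t)) \<longlongrightarrow> - \<mu> * (E 0 * exp (- \<mu> * t)) + \<epsilon>) (at_left t)"
      by (simp add: has_field_derivative_iff)
    moreover have "- \<mu> * \<psi> t + \<epsilon> / 2 < - \<mu> * (E 0 * exp (- \<mu> * t)) + \<epsilon>"
    proof -
      have "0 < \<mu> * \<epsilon> * (1 + t)" using \<open>0 < \<mu>\<close> \<epsilon> \<open>0 < t\<close> by simp
      with \<epsilon> show ?thesis by (simp add: \<psi>_def algebra_simps)
    qed
    ultimately have "\<forall>\<^sub>F \<tau> in at_left t. - \<mu> * \<psi> t + \<epsilon> / 2 < (\<psi> \<tau> - \<psi> t) / (\<tau> - t)"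
      by (rule order_tendstoD(1))
    moreover have "\<forall>\<^sub>F \<tau> in at_left t. E t - E \<tau> \<le> (t - \<tau>) * (- \<mu> * E t + \<epsilon> / 2)"
      using dini \<open>0 < t\<close> \<epsilon> by simp
    moreover have "\<forall>\<^sub>F \<tau> in at_left t. \<tau> \<in> {0<..<t}"
      using \<open>0 < t\<close> by (rule eventually_at_left_real)
    ultimately have "\<forall>\<^sub>F \<tau> in at_left t. False"
    proof eventually_elim
      case (elim \<tau>)
      then have "\<tau> < t" by simp
      have "\<tau> \<notin> A" using t(2)[of \<tau>] \<open>\<tau> < t\<close> by auto
      then have "E \<tau> < \<psi> \<tau>" using elim \<open>t \<le> T\<close> by (auto simp: A_def)
      have "(- \<mu> * \<psi> t + \<epsilon> / 2) * (t - \<tau>) < (\<psi> \<tau> - \<psi> t) / (\<tau> - t) * (t - \<tau>)"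
        using elim \<open>\<tau> < t\<close> by (intro mult_strict_right_mono) auto
      also have "\<dots> = \<psi> t - \<psi> \<tau>" using \<open>\<tau> < t\<close> by (simp add: field_simps)
      also have "\<dots> \<le> E t - E \<tau>" using \<open>E \<tau> < \<psi> \<tau>\<close> \<open>\<psi> t \<le> E t\<close> by simp
      also have "\<dots> \<le> (t - \<tau>) * (- \<mu> * E t + \<epsilon> / 2)" using elim by simp
      also have "\<dots> \<le> (t - \<tau>) * (- \<mu> * \<psi> t + \<epsilon> / 2)"
        using \<open>\<tau> < t\<close> \<open>\<psi> t \<le> E t\<close> \<open>0 < \<mu>\<close> by (intro mult_left_mono) auto
      finally show False by (simp add: mult.commute)
    qed
    then show False by simp
  qed
  also have "\<psi> T = E 0 * exp (- \<mu> * T) + e" using \<open>0 \<le> T\<close> by (simp add: \<psi>_def \<epsilon>_def)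
  finally show "E T \<le> E 0 * exp (- \<mu> * T) + e" .
qed

section \<open>Auxiliary facts for integrals and domains cut off at a front\<close>

lemma has_integral_cut:
  fixes g :: "real \<Rightarrow> real"
  assumes "(g has_integral i) {a..S}" "S \<le> L"
  shows "((\<lambda>x. if x \<le> S then g x else 0) has_integral i) {a..L}"
proof -
  have "((\<lambda>x. if x \<in> {a..S} then g x else 0) has_integral i) {a..L}"
    using assms by (subst has_integral_restrict) auto
  then show ?thesis by (rule has_integral_eq[rotated]) auto
qed

lemma continuous_on_bstep:
  assumes "continuous_on {0..S} r"
  shows "continuous_on {0..S} (bstep c S r)"
  unfolding bstep_def[abs_def]
  by (intro continuous_intros assms, rule DERIV_continuous_on)
    (rule DERIV_integral_lower[OF DERIV_ker(1) continuous_on_ker_pair(1,2) assms])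

text \<open>The transformation is bounded on L1 with constant 1 + K S. This is how L1 convergence of
  the difference quotients of u passes to the pairing of their transforms with w_xx.\<close>

lemma integral_mult_bstep_le:
  assumes S: "0 \<le> S" and r: "continuous_on {0..S} r" and h: "continuous_on {0..S} h"
    and H: "\<And>x. x \<in> {0..S} \<Longrightarrow> \<bar>h x\<bar> \<le> H"
    and K: "\<And>x y. x \<in> {0..S} \<Longrightarrow> y \<in> {0..S} \<Longrightarrow> \<bar>ker c x y\<bar> \<le> K"
  shows "\<bar>integral {0..S} (\<lambda>x. h x * bstep c S r x)\<bar> \<le> H * (1 + K * S) * integral {0..S} (\<lambda>x. \<bar>r x\<bar>)"
proof -
  define I where "I = integral {0..S} (\<lambda>x. \<bar>r x\<bar>)"
  have K0: "0 \<le> K" using K[of 0 0] S by auto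
  have H0: "0 \<le> H" using H[of 0] S by auto
  have b: "\<bar>bstep c S r x\<bar> \<le> \<bar>r x\<bar> + K * I" if x: "x \<in> {0..S}" for x
  proof -
    have rx: "continuous_on {x..S} r" using r x by (auto elim: continuous_on_subset)
    have "\<bar>integral {x..S} (\<lambda>y. ker c x y * r y)\<bar> \<le> integral {x..S} (\<lambda>y. K * \<bar>r y\<bar>)"
      using x by (intro abs_integral_le integrable_continuous_real continuous_intros rx)
        (auto simp: abs_mult intro!: mult_right_mono K)
    also have "\<dots> \<le> integral {0..S} (\<lambda>y. K * \<bar>r y\<bar>)"
      using x K0 by (intro integral_subset_le) (auto intro!: integrable_continuous_real continuous_intros r rx)
    finally show ?thesis by (simp add: bstep_def I_def)
  qed
  have "\<bar>integral {0..S} (\<lambda>x. h x * bstep c S r x)\<bar> \<le> integral {0..S} (\<lambda>x. H * (\<bar>r x\<bar> + K * I))"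
    using H0 by (intro abs_integral_le integrable_continuous_real continuous_intros r h continuous_on_bstep)
      (auto simp: abs_mult intro!: mult_mono b H)
  also have "\<dots> = H * (I + K * I * S)"
  proof -
    have "((\<lambda>x. H * (\<bar>r x\<bar> + K * I)) has_integral H * (I + K * I * S)) {0..S}"
      using has_integral_const_real[of "K * I" 0 S] S unfolding I_def
      by (intro has_integral_mult_right has_integral_add integrable_integral integrable_continuous_real continuous_intros r)
        (simp add: mult.commute)
    then show ?thesis by (rule integral_unique)
  qed
  finally show ?thesis by (simp add: I_def algebra_simps)
qed

lemma continuous_on_slice:
  assumes "continuous_on A (\<lambda>(x, t). f x t)" "\<And>x. x \<in> X \<Longrightarrow> (x, t) \<in> A"
  shows "continuous_on X (\<lambda>x. f x t)"
proof -
  have "continuous_on X (\<lambda>x. (x, t))" by (intro continuous_intros)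
  from continuous_on_compose2[OF assms(1) this] assms(2) show ?thesis by auto
qed

text \<open>The map (\<theta>, t) to (\<theta> s(t), t) straightens the moving boundary: the strip
  is the continuous image of a rectangle, with \<theta> = x / s(t) recovered from s(t) > 0.\<close>

lemma compact_strip:
  fixes s :: "real \<Rightarrow> real"
  assumes s_cont: "continuous_on {0..} s" and s_pos: "\<And>t. 0 \<le> t \<Longrightarrow> 0 < s t" and "0 \<le> a"
  shows "compact {(x, t). a \<le> t \<and> t \<le> b \<and> 0 \<le> x \<and> x \<le> s t}"
proof -
  have "{(x, t). a \<le> t \<and> t \<le> b \<and> 0 \<le> x \<and> x \<le> s t} = (\<lambda>(\<theta>, t). (\<theta> * s t, t)) ` ({0..1} \<times> {a..b})"
  proof (intro set_eqI iffI)
    fix z assume "z \<in> {(x, t). a \<le> t \<and> t \<le> b \<and> 0 \<le> x \<and> x \<le> s t}"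
    then obtain x t where z: "z = (x, t)" "a \<le> t" "t \<le> b" "0 \<le> x" "x \<le> s t" by auto
    with s_pos[of t] assms(3) have "z = (\<lambda>(\<theta>, t). (\<theta> * s t, t)) (x / s t, t)" "(x / s t, t) \<in> {0..1} \<times> {a..b}"
      by (auto simp: field_simps)
    then show "z \<in> (\<lambda>(\<theta>, t). (\<theta> * s t, t)) ` ({0..1} \<times> {a..b})" by blast
  next
    fix z assume "z \<in> (\<lambda>(\<theta>, t). (\<theta> * s t, t)) ` ({0..1} \<times> {a..b})"
    then obtain p where "p \<in> {0..1} \<times> {a..b}" "z = (\<lambda>(\<theta>, t). (\<theta> * s t, t)) p" by blast
    then obtain \<theta> t where z: "z = (\<theta> * s t, t)" "0 \<le> \<theta>" "\<theta> \<le> 1" "a \<le> t" "t \<le> b"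
      by (cases p) auto
    moreover have "\<theta> * s t \<le> 1 * s t" using z s_pos[of t] assms(3) by (intro mult_right_mono) auto
    ultimately show "z \<in> {(x, t). a \<le> t \<and> t \<le> b \<and> 0 \<le> x \<and> x \<le> s t}"
      using s_pos[of t] assms(3) by auto
  qed
  moreover have "compact ((\<lambda>(\<theta>, t). (\<theta> * s t, t)) ` ({0..1} \<times> {a..b}))"
    unfolding split_beta using assms(3)
    by (intro compact_continuous_image compact_Times compact_Icc continuous_intros
        continuous_on_compose2[OF s_cont]) auto
  ultimately show ?thesis by simp
qed

section \<open>The error system on the moving domain\<close>

text \<open>Here u = T - Th. The injected quantity Y'(t) / \<beta> + Th_x(s(t),t) equals -
  u_x(s(t),t), which together with the sign of the gain yields the plus sign in the equation for
  u_t. The slopes are separate functions, since at t = 0 the difference of the slopes of T and Th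
  need not be the slope of u on the exceptional set N.\<close>

locale error_system =
  fixes \<alpha> lam L :: real and s :: "real \<Rightarrow> real" and u ux uxx :: "real \<Rightarrow> real \<Rightarrow> real" and N :: "real set"
  assumes \<alpha>: "0 < \<alpha>" and lam: "0 < lam" and N: "finite N"
    and s_cont: "continuous_on {0..} s"
    and s_pos: "0 \<le> t \<Longrightarrow> 0 < s t"
    and s_mono: "0 \<le> t \<Longrightarrow> t \<le> t' \<Longrightarrow> s t \<le> s t'"
    and s_le: "0 \<le> t \<Longrightarrow> s t \<le> L"
    and s_diff: "0 < t \<Longrightarrow> \<exists>d. (s has_real_derivative d) (at t)"
    and u_cont: "continuous_on (space_time s) (\<lambda>(x, t). u x t)"
    and u_x: "0 < t \<Longrightarrow> x \<in> {0..s t} \<Longrightarrow> ((\<lambda>y. u y t) has_real_derivative ux x t) (at x within {0..s t})"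
    and ux_x: "0 < t \<Longrightarrow> x \<in> {0..s t} \<Longrightarrow> ((\<lambda>y. ux y t) has_real_derivative uxx x t) (at x within {0..s t})"
    and ux_cont: "continuous_on (space_time s - N \<times> {0}) (\<lambda>(x, t). ux x t)"
    and uxx_cont: "continuous_on (space_time s \<inter> {(x, t). 0 < t}) (\<lambda>(x, t). uxx x t)"
    and ux_bounded_near_0: "\<exists>M. \<exists>\<delta>>0. \<forall>t\<in>{0<..\<delta>}. \<forall>x\<in>{0..s t}. \<bar>ux x t\<bar> \<le> M"
    and u_t: "0 < t \<Longrightarrow> x \<in> {0..s t} \<Longrightarrow> ((\<lambda>\<tau>. u x \<tau>) has_real_derivative
          \<alpha> * uxx x t + lam * s t / 2 * phi 1 (lam / \<alpha> / 4 * ((s t)\<^sup>2 - x\<^sup>2)) * ux (s t) t)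
          (at t within active_times s x)"
    and ux_0: "0 < t \<Longrightarrow> ux 0 t = 0"
    and u_s: "0 < t \<Longrightarrow> u (s t) t = 0"
begin

definition wx :: "real \<Rightarrow> real \<Rightarrow> real" where
  "wx x t = bstep_x (lam / \<alpha>) (s t) (\<lambda>y. u y t) (\<lambda>y. ux y t) x"

definition energy :: "real \<Rightarrow> real" where
  "energy t = integral {0..s t} (\<lambda>x. (wx x t)\<^sup>2)"

definition u_cut :: "real \<Rightarrow> real \<Rightarrow> real" where
  "u_cut x t = (if x \<le> s t then u x t else 0)"

text \<open>Taking the right-hand side of the equation instead of a time derivative makes joint
  continuity a matter of the spatial regularity of u.\<close>

definition ut :: "real \<Rightarrow> real \<Rightarrow> real" where
  "ut x t = \<alpha> * uxx x t + lam * s t / 2 * phi 1 (lam / \<alpha> / 4 * ((s t)\<^sup>2 - x\<^sup>2)) * ux (s t) t"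

lemma s_isCont: "0 < t \<Longrightarrow> isCont s t"
  using s_diff DERIV_isCont by blast

lemma s_tendsto: "0 \<le> t \<Longrightarrow> (s \<longlongrightarrow> s t) (at t within {0..})"
  using s_cont by (simp add: continuous_on_def)

lemma u_profile_cont: "0 \<le> t \<Longrightarrow> continuous_on {0..s t} (\<lambda>x. u x t)"
  by (rule continuous_on_slice[OF u_cont]) (simp add: space_time_def)

lemma ux_profile_cont: "0 < t \<Longrightarrow> continuous_on {0..s t} (\<lambda>x. ux x t)"
  by (rule DERIV_continuous_on) (rule ux_x)

lemma uxx_profile_cont: "0 < t \<Longrightarrow> continuous_on {0..s t} (\<lambda>x. uxx x t)"
  by (rule continuous_on_slice[OF uxx_cont]) (simp add: space_time_def)

lemma strip_bounded:
  assumes "0 \<le> a" "continuous_on {(x, t). a \<le> t \<and> t \<le> b \<and> 0 \<le> x \<and> x \<le> s t} (\<lambda>(x, t). f x t)"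
  obtains B :: real where "0 < B" "\<And>x t. a \<le> t \<Longrightarrow> t \<le> b \<Longrightarrow> x \<in> {0..s t} \<Longrightarrow> \<bar>f x t\<bar> \<le> B"
proof -
  have "bounded ((\<lambda>(x, t). f x t) ` {(x, t). a \<le> t \<and> t \<le> b \<and> 0 \<le> x \<and> x \<le> s t})"
    by (intro compact_imp_bounded compact_continuous_image compact_strip[OF s_cont s_pos] assms)
  then obtain B where "0 < B" "\<And>z. z \<in> (\<lambda>(x, t). f x t) ` {(x, t). a \<le> t \<and> t \<le> b \<and> 0 \<le> x \<and> x \<le> s t} \<Longrightarrow> norm z \<le> B"
    unfolding bounded_pos by blast
  then show ?thesis by (intro that[of B]) auto
qed

lemma u_bounded:
  obtains B where "0 < B" "\<And>x t. 0 \<le> t \<Longrightarrow> t \<le> b \<Longrightarrow> x \<in> {0..s t} \<Longrightarrow> \<bar>u x t\<bar> \<le> B"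
  by (rule strip_bounded[of 0 b u])
    (auto intro: continuous_on_subset[OF u_cont] simp: space_time_def)

text \<open>Joint continuity of the slope may fail on N at time 0, so compactness works only for
  times from some \<delta> > 0 on; the initial layer is covered by the assumed bound.\<close>

lemma ux_bounded:
  obtains B where "0 < B" "\<And>x t. 0 < t \<Longrightarrow> t \<le> b \<Longrightarrow> x \<in> {0..s t} \<Longrightarrow> \<bar>ux x t\<bar> \<le> B"
proof -
  obtain M \<delta> where \<delta>: "0 < \<delta>" and M: "\<And>t x. t \<in> {0<..\<delta>} \<Longrightarrow> x \<in> {0..s t} \<Longrightarrow> \<bar>ux x t\<bar> \<le> M"
    using ux_bounded_near_0 by blast
  obtain B where B: "0 < B" "\<And>x t. \<delta> \<le> t \<Longrightarrow> t \<le> b \<Longrightarrow> x \<in> {0..s t} \<Longrightarrow> \<bar>ux x t\<bar> \<le> B"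
    by (rule strip_bounded[of \<delta> b ux])
      (use \<delta> in \<open>auto intro: continuous_on_subset[OF ux_cont] simp: space_time_def\<close>)
  show ?thesis
  proof (rule that[of "B + \<bar>M\<bar>"])
    fix x t assume "0 < t" "t \<le> b" "x \<in> {0..s t}"
    then show "\<bar>ux x t\<bar> \<le> B + \<bar>M\<bar>"
      using M[of t x] B(2)[of t x] B(1) by (cases "t \<le> \<delta>") auto
  qed (use B in auto)
qed

lemma eventually_below_s:
  assumes "0 \<le> t" "x < s t"
  shows "\<forall>\<^sub>F \<tau> in at t within {0..}. x < s \<tau>"
  using s_tendsto[OF assms(1)] assms(2) by (rule order_tendstoD)

lemma eventually_above_s:
  assumes "0 \<le> t" "s t < x"
  shows "\<forall>\<^sub>F \<tau> in at t within {0..}. s \<tau> < x"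
  using s_tendsto[OF assms(1)] assms(2) by (rule order_tendstoD)

lemma eventually_pos:
  assumes "0 \<le> (t :: real)"
  shows "\<forall>\<^sub>F \<tau> in at t within {0..}. 0 < \<tau> \<and> \<tau> \<le> t + 1"
proof -
  have "\<forall>\<^sub>F \<tau> in at t within {0..}. \<tau> < t + 1"
    using order_tendstoD(2)[OF tendsto_ident_at[of t "{0..}"], of "t + 1"] by simp
  moreover have "\<forall>\<^sub>F \<tau> in at t within {0..}. \<tau> \<in> {0..} \<and> \<tau> \<noteq> t"
    by (simp add: eventually_at_filter)
  moreover have "\<forall>\<^sub>F \<tau> in at t within {0..}. 0 < t \<longrightarrow> 0 < \<tau>"
    using order_tendstoD(1)[OF tendsto_ident_at[of t "{0..}"], of 0] by (cases "0 < t") auto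
  ultimately show ?thesis by eventually_elim (use assms in auto)
qed

lemma nontrivial_time:
  assumes "0 \<le> (t :: real)"
  shows "at t within {0..} \<noteq> bot"
proof -
  have "at t within {t<..} \<le> at t within {0..}" using assms by (intro at_le) auto
  then show ?thesis using trivial_limit_at_right_real[of t] by (auto simp: bot_unique)
qed

text \<open>For x strictly below the front, (x, \<tau>) stays in the domain for all \<tau> near t,
  so that joint continuity can be restricted to this line. At x = s(t) the line may leave the
  domain, hence that point is treated as exceptional in the limits of integrals.\<close>

lemma tendsto_time:
  fixes f :: "real \<Rightarrow> real \<Rightarrow> real"
  assumes f: "continuous_on (space_time s - M \<times> {0}) (\<lambda>(x, t). f x t)"
    and t: "0 \<le> t" "0 < t \<or> x \<notin> M" and x: "0 \<le> x" "x < s t"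
  shows "((\<lambda>\<tau>. f x \<tau>) \<longlongrightarrow> f x t) (at t within {0..})"
proof -
  have "(x, t) \<in> space_time s - M \<times> {0}" using t x by (auto simp: space_time_def)
  then have "continuous (at (x, t) within space_time s - M \<times> {0}) (\<lambda>(x, t). f x t)"
    using f by (simp add: continuous_on_eq_continuous_within)
  moreover have "\<forall>\<^sub>F \<tau> in at t within {0..}. (x, \<tau>) \<in> space_time s - M \<times> {0}"
    using eventually_below_s[OF t(1) x(2)] eventually_pos[OF t(1)]
    by eventually_elim (use x in \<open>auto simp: space_time_def\<close>)
  moreover have "((\<lambda>\<tau>. (x, \<tau>)) \<longlongrightarrow> (x, t)) (at t within {0..})"
    by (intro tendsto_intros)
  ultimately have "((\<lambda>\<tau>. case (x, \<tau>) of (x, t) \<Rightarrow> f x t) \<longlongrightarrow> (case (x, t) of (x, t) \<Rightarrow> f x t)) (at t within {0..})"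
    by (rule continuous_within_tendsto_compose)
  then show ?thesis by simp
qed

text \<open>Extension by zero to {x..L} fixes the interval; the integrands then converge at every
  point but s(t) and are uniformly bounded.\<close>

lemma integral_u_tendsto:
  assumes k: "continuous_on {0..L} k" and t: "0 \<le> t" and x: "0 \<le> x" "x < s t"
  shows "((\<lambda>\<tau>. integral {x..s \<tau>} (\<lambda>y. k y * u y \<tau>)) \<longlongrightarrow> integral {x..s t} (\<lambda>y. k y * u y t)) (at t within {0..})"
proof -
  have int: "(\<lambda>y. k y * u y \<tau>) integrable_on {x..s \<tau>}" if "0 \<le> \<tau>" for \<tau>
    using x that s_le[of \<tau>]
    by (intro integrable_continuous_real continuous_intros continuous_on_subset[OF k]
        continuous_on_subset[OF u_profile_cont]) auto
  have cut: "((\<lambda>y. if y \<le> s \<tau> then k y * u y \<tau> else 0) has_integral integral {x..s \<tau>} (\<lambda>y. k y * u y \<tau>)) {x..L}"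
    if "0 \<le> \<tau>" for \<tau>
    by (rule has_integral_cut[OF integrable_integral[OF int[OF that]] s_le[OF that]])
  obtain B where B: "0 < B" "\<And>x \<tau>. 0 \<le> \<tau> \<Longrightarrow> \<tau> \<le> t + 1 \<Longrightarrow> x \<in> {0..s \<tau>} \<Longrightarrow> \<bar>u x \<tau>\<bar> \<le> B"
    by (rule u_bounded[of "t + 1"]) blast
  have "bounded (k ` {0..L})" by (intro compact_imp_bounded compact_continuous_image k compact_Icc)
  then obtain M where M: "0 < M" "\<And>y. y \<in> {0..L} \<Longrightarrow> \<bar>k y\<bar> \<le> M"
    unfolding bounded_pos by auto
  let ?f = "\<lambda>\<tau> y. if y \<le> s \<tau> then k y * u y \<tau> else 0"
  have "((\<lambda>\<tau>. integral {x..L} (?f \<tau>)) \<longlongrightarrow> integral {x..L} (?f t)) (at t within {0..})"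
  proof (rule bounded_convergence(2)[where N = "{s t}" and B = "M * B"])
    show "\<forall>\<^sub>F \<tau> in at t within {0..}. ?f \<tau> integrable_on {x..L} \<and> (\<forall>y\<in>{x..L} - {s t}. \<bar>?f \<tau> y\<bar> \<le> M * B)"
      using eventually_pos[OF t]
    proof eventually_elim
      case (elim \<tau>)
      then show ?case
        using cut[of \<tau>] M B x by (auto simp: abs_mult integrable_on_def intro!: mult_mono)
    qed
    fix y assume y: "y \<in> {x..L} - {s t}"
    show "((\<lambda>\<tau>. ?f \<tau> y) \<longlongrightarrow> ?f t y) (at t within {0..})"
    proof (cases "y < s t")
      case True
      have "((\<lambda>\<tau>. k y * u y \<tau>) \<longlongrightarrow> k y * u y t) (at t within {0..})"
        using y x t True by (intro tendsto_intros tendsto_time[of "{}"]) (auto intro: u_cont)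
      moreover have "\<forall>\<^sub>F \<tau> in at t within {0..}. k y * u y \<tau> = ?f \<tau> y"
        using eventually_below_s[OF t True] by eventually_elim simp
      ultimately show ?thesis using True by (auto intro: Lim_transform_eventually)
    next
      case False
      then have "\<forall>\<^sub>F \<tau> in at t within {0..}. ?f \<tau> y = 0"
        using eventually_above_s[OF t, of y] y by (auto elim: eventually_mono)
      then show ?thesis using False y by (auto intro: tendsto_eventually)
    qed
  qed (simp_all add: nontrivial_time[OF t])
  moreover have "\<forall>\<^sub>F \<tau> in at t within {0..}. integral {x..L} (?f \<tau>) = integral {x..s \<tau>} (\<lambda>y. k y * u y \<tau>)"
    using eventually_pos[OF t] by eventually_elim (intro integral_unique cut, simp)
  ultimately show ?thesis
    using integral_unique[OF cut[OF t]] by (auto intro: Lim_transform_eventually)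
qed

lemma wx_profile_cont:
  assumes "0 < t"
  shows "continuous_on {0..s t} (\<lambda>x. wx x t)"
  unfolding wx_def
proof (rule DERIV_continuous_on)
  fix x assume "x \<in> {0..s t}"
  with assms show "(bstep_x (lam / \<alpha>) (s t) (\<lambda>y. u y t) (\<lambda>y. ux y t) has_real_derivative
     bstep_xx (lam / \<alpha>) (s t) (\<lambda>y. u y t) (\<lambda>y. ux y t) (\<lambda>y. uxx y t) x) (at x within {0..s t})"
    by (intro DERIV_bstep_x u_profile_cont u_x ux_x) auto
qed

lemma wx_tendsto:
  assumes t: "0 \<le> t" "0 < t \<or> x \<notin> N" and x: "0 \<le> x" "x < s t"
  shows "((\<lambda>\<tau>. wx x \<tau>) \<longlongrightarrow> wx x t) (at t within {0..})"
  unfolding wx_def bstep_x_def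
  by (intro tendsto_intros tendsto_time[OF ux_cont t x] integral_u_tendsto t x continuous_intros
      tendsto_time[of "{}"]) (auto intro: u_cont)

lemma wx_bounded:
  obtains B where "\<And>x t. 0 < t \<Longrightarrow> t \<le> b \<Longrightarrow> x \<in> {0..s t} \<Longrightarrow> \<bar>wx x t\<bar> \<le> B"
proof -
  obtain K where K: "0 < K"
    and ker: "\<And>x y. x \<in> {0..L} \<Longrightarrow> y \<in> {0..L} \<Longrightarrow> \<bar>ker (lam / \<alpha>) x y\<bar> \<le> K \<and> \<bar>ker_x (lam / \<alpha>) x y\<bar> \<le> K"
    and cx: "\<And>x. x \<in> {0..L} \<Longrightarrow> \<bar>lam / \<alpha> * x / 2\<bar> \<le> K"
    by (rule kernel_bound[of L "lam / \<alpha>"]) blast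
  obtain A where A: "0 < A" "\<And>x t. 0 \<le> t \<Longrightarrow> t \<le> b \<Longrightarrow> x \<in> {0..s t} \<Longrightarrow> \<bar>u x t\<bar> \<le> A"
    by (rule u_bounded[of b]) blast
  obtain B where B: "0 < B" "\<And>x t. 0 < t \<Longrightarrow> t \<le> b \<Longrightarrow> x \<in> {0..s t} \<Longrightarrow> \<bar>ux x t\<bar> \<le> B"
    by (rule ux_bounded[of b]) blast
  show ?thesis
  proof (rule that[of "B + K * A + K * A * L"])
    fix x t assume t: "0 < t" "t \<le> b" and x: "x \<in> {0..s t}"
    have sL: "s t \<le> L" using s_le t by simp
    let ?I = "integral {x..s t} (\<lambda>y. ker_x (lam / \<alpha>) x y * u y t)"
    have "\<bar>?I\<bar> \<le> integral {x..s t} (\<lambda>y. K * A)"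
      using x t sL K A ker[of x]
      by (intro abs_integral_le integrable_continuous_real continuous_intros continuous_on_subset[OF u_profile_cont])
        (auto simp: abs_mult intro!: mult_mono)
    also have "\<dots> = K * A * (s t - x)" using x by simp
    also have "\<dots> \<le> K * A * L" using x sL K A by (intro mult_left_mono) auto
    finally have I: "\<bar>?I\<bar> \<le> K * A * L" .
    have "\<bar>lam / \<alpha> * x / 2 * u x t\<bar> \<le> K * A"
      unfolding abs_mult[of _ "u x t"] using cx[of x] A(2)[of t x] x t sL K by (intro mult_mono) auto
    moreover have "wx x t = ux x t + lam / \<alpha> * x / 2 * u x t - ?I" by (simp add: wx_def bstep_x_def)
    ultimately show "\<bar>wx x t\<bar> \<le> B + K * A + K * A * L"
      using I B(2)[OF t x] by linarith
  qed
qed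

text \<open>Again the profiles are extended by zero to {0..L}. At t = 0 the integrability claim has
  content: the initial slope is reached only as a bounded pointwise limit, off finitely many points,
  of the continuous slopes at later times.\<close>

lemma square_convergence:
  fixes F :: "real \<Rightarrow> real \<Rightarrow> real"
  assumes t: "0 \<le> t"
    and cont: "\<And>\<tau>. 0 < \<tau> \<Longrightarrow> continuous_on {0..s \<tau>} (\<lambda>x. F x \<tau>)"
    and bd: "\<And>x \<tau>. 0 < \<tau> \<Longrightarrow> \<tau> \<le> t + 1 \<Longrightarrow> x \<in> {0..s \<tau>} \<Longrightarrow> \<bar>F x \<tau>\<bar> \<le> B"
    and lim: "\<And>x. 0 < t \<or> x \<notin> N \<Longrightarrow> 0 \<le> x \<Longrightarrow> x < s t \<Longrightarrow> ((\<lambda>\<tau>. F x \<tau>) \<longlongrightarrow> F x t) (at t within {0..})"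
  shows "(\<lambda>x. (F x t)\<^sup>2) integrable_on {0..s t}"
    and "((\<lambda>\<tau>. integral {0..s \<tau>} (\<lambda>x. (F x \<tau>)\<^sup>2)) \<longlongrightarrow> integral {0..s t} (\<lambda>x. (F x t)\<^sup>2)) (at t within {0..})"
proof -
  let ?f = "\<lambda>\<tau> x. if x \<in> {0..s \<tau>} then (F x \<tau>)\<^sup>2 else 0"
  have sub: "{0..s \<tau>} \<subseteq> {0..L}" if "0 \<le> \<tau>" for \<tau> using s_le[OF that] by auto
  have ev: "\<forall>\<^sub>F \<tau> in at t within {0..}. ?f \<tau> integrable_on {0..L} \<and> (\<forall>x\<in>{0..L} - insert (s t) N. \<bar>?f \<tau> x\<bar> \<le> B\<^sup>2)"
    using eventually_pos[OF t]
  proof eventually_elim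
    case (elim \<tau>)
    have "(\<lambda>x. (F x \<tau>)\<^sup>2) integrable_on {0..s \<tau>}"
      using elim by (intro integrable_continuous_real continuous_intros cont) simp
    then have "?f \<tau> integrable_on {0..L}"
      using s_le[of \<tau>] elim by (simp add: integrable_restrict_Int min_absorb1 del: atLeastAtMost_iff)
    moreover have "\<bar>?f \<tau> x\<bar> \<le> B\<^sup>2" for x
      using bd[of \<tau> x] elim power_mono[of "\<bar>F x \<tau>\<bar>" B 2] by auto
    ultimately show ?case by blast
  qed
  have conv: "((\<lambda>\<tau>. ?f \<tau> x) \<longlongrightarrow> ?f t x) (at t within {0..})" if x: "x \<in> {0..L} - insert (s t) N" for x
  proof (cases "x < s t")
    case True
    have "((\<lambda>\<tau>. (F x \<tau>)\<^sup>2) \<longlongrightarrow> (F x t)\<^sup>2) (at t within {0..})"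
      using x True by (intro tendsto_intros lim) auto
    moreover have "\<forall>\<^sub>F \<tau> in at t within {0..}. (F x \<tau>)\<^sup>2 = ?f \<tau> x"
      using eventually_below_s[OF t True] by eventually_elim (use x in auto)
    ultimately show ?thesis using True x by (auto intro: Lim_transform_eventually)
  next
    case False
    then have "\<forall>\<^sub>F \<tau> in at t within {0..}. ?f \<tau> x = 0"
      using eventually_above_s[OF t, of x] x by (auto elim!: eventually_mono)
    then show ?thesis using False x by (auto intro: tendsto_eventually)
  qed
  have fin: "finite (insert (s t) N)" using N by simp
  note * = bounded_convergence[OF fin ev conv nontrivial_time[OF t]]
  have int: "integral {0..L} (?f \<tau>) = integral {0..s \<tau>} (\<lambda>x. (F x \<tau>)\<^sup>2)" if "0 \<le> \<tau>" for \<tau>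
    using sub[OF that] by (simp only: integral_restrict_Int Int_absorb2)
  show "(\<lambda>x. (F x t)\<^sup>2) integrable_on {0..s t}"
    using *(1) unfolding integrable_on_def has_integral_restrict[OF sub[OF t]] .
  have "\<forall>\<^sub>F \<tau> in at t within {0..}. integral {0..L} (?f \<tau>) = integral {0..s \<tau>} (\<lambda>x. (F x \<tau>)\<^sup>2)"
    using eventually_pos[OF t] by eventually_elim (intro int, simp)
  with *(2) show "((\<lambda>\<tau>. integral {0..s \<tau>} (\<lambda>x. (F x \<tau>)\<^sup>2)) \<longlongrightarrow> integral {0..s t} (\<lambda>x. (F x t)\<^sup>2)) (at t within {0..})"
    unfolding int[OF t] by (rule Lim_transform_eventually)
qed

lemma ux_square_integrable: "(\<lambda>x. (ux x 0)\<^sup>2) integrable_on {0..s 0}"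
proof -
  obtain B where "\<And>x t. 0 < t \<Longrightarrow> t \<le> 0 + 1 \<Longrightarrow> x \<in> {0..s t} \<Longrightarrow> \<bar>ux x t\<bar> \<le> B"
    by (rule ux_bounded[of "0 + 1"]) blast
  from square_convergence(1)[OF order_refl ux_profile_cont this tendsto_time[OF ux_cont]]
  show ?thesis by simp
qed

lemma wx_convergence:
  assumes t: "0 \<le> t"
  shows "(\<lambda>x. (wx x t)\<^sup>2) integrable_on {0..s t}" "(energy \<longlongrightarrow> energy t) (at t within {0..})"
proof -
  obtain B where "\<And>x \<tau>. 0 < \<tau> \<Longrightarrow> \<tau> \<le> t + 1 \<Longrightarrow> x \<in> {0..s \<tau>} \<Longrightarrow> \<bar>wx x \<tau>\<bar> \<le> B"
    by (rule wx_bounded[of "t + 1"]) blast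
  note * = square_convergence[OF t wx_profile_cont this wx_tendsto[OF t]]
  show "(\<lambda>x. (wx x t)\<^sup>2) integrable_on {0..s t}" by (rule *(1))
  show "(energy \<longlongrightarrow> energy t) (at t within {0..})" unfolding energy_def[abs_def] by (rule *(2))
qed

lemma energy_cont: "continuous_on {0..} energy"
  unfolding continuous_on_def using wx_convergence(2) by simp

lemma ut_cont:
  "continuous_on (space_time s \<inter> {(x, t). 0 < t}) (\<lambda>(x, t). ut x t)"
proof -
  let ?A = "space_time s \<inter> {(x, t). 0 < t}"
  have s: "continuous_on ?A (\<lambda>z. s (snd z))"
    by (rule continuous_on_compose2[OF s_cont]) (auto intro!: continuous_intros simp: less_imp_le)
  have "continuous_on ?A (\<lambda>z. (s (snd z), snd z))"
    by (intro continuous_on_Pair s continuous_on_snd continuous_on_id)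
  moreover have "(\<lambda>z. (s (snd z), snd z)) ` ?A \<subseteq> space_time s - N \<times> {0}"
    using s_pos by (auto simp: space_time_def less_imp_le)
  ultimately have "continuous_on ?A (\<lambda>z. (\<lambda>(x, t). ux x t) (s (snd z), snd z))"
    by (rule continuous_on_compose2[OF ux_cont])
  then have u: "continuous_on ?A (\<lambda>z. ux (s (snd z)) (snd z))" by simp
  have uu: "continuous_on ?A (\<lambda>z. uxx (fst z) (snd z))" using uxx_cont by (simp add: split_beta)
  have p: "continuous_on ?A (\<lambda>z. phi 1 (lam / \<alpha> / 4 * ((s (snd z))\<^sup>2 - (fst z)\<^sup>2)))"
    by (intro continuous_on_phi continuous_intros s)
  have "continuous_on ?A (\<lambda>z. ut (fst z) (snd z))" unfolding ut_def
    by (intro continuous_on_add continuous_on_mult continuous_on_divide continuous_on_const s u uu p) simp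
  then show ?thesis by (simp add: split_beta)
qed

lemma ut_profile_cont: "0 < t \<Longrightarrow> continuous_on {0..s t} (\<lambda>x. ut x t)"
  by (rule continuous_on_slice[OF ut_cont]) (simp add: space_time_def)

lemma u_cut_cont:
  assumes "0 < t"
  shows "continuous_on {0..b} (\<lambda>x. u_cut x t)"
proof -
  have "continuous_on {x \<in> {0..b}. x \<le> s t} (\<lambda>x. u x t)"
    using assms by (intro continuous_on_subset[OF u_profile_cont]) auto
  then show ?thesis unfolding u_cut_def
    by (intro continuous_on_cases_le) (use u_s[OF assms] in \<open>auto intro!: continuous_intros\<close>)
qed

section \<open>Backward difference quotients and the Dini inequality\<close>

definition diff_quotient :: "real \<Rightarrow> real \<Rightarrow> real \<Rightarrow> real" where
  "diff_quotient t \<tau> x = (u x t - u_cut x \<tau>) / (t - \<tau>)"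

lemma diff_quotient_tendsto:
  assumes t: "0 < t" and x: "0 \<le> x" "x < s t"
  shows "((\<lambda>\<tau>. diff_quotient t \<tau> x) \<longlongrightarrow> ut x t) (at_left t)"
proof -
  have "(s \<longlongrightarrow> s t) (at_left t)"
    using s_isCont[OF t] by (simp add: isCont_def filterlim_at_split)
  then have below: "\<forall>\<^sub>F \<tau> in at_left t. x < s \<tau>" using x(2) by (rule order_tendstoD)
  moreover have "\<forall>\<^sub>F \<tau> in at_left t. \<tau> \<in> {0<..<t}" using t by (rule eventually_at_left_real)
  ultimately have "\<forall>\<^sub>F \<tau> in at_left t. \<tau> \<in> {0<..<t} \<and> x < s \<tau>" by eventually_elim simp
  then obtain r where r: "r < t" "\<And>\<tau>. r < \<tau> \<Longrightarrow> \<tau> < t \<Longrightarrow> \<tau> \<in> {0<..<t} \<and> x < s \<tau>"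
    unfolding eventually_at_left_field by auto
  have "((\<lambda>\<tau>. u x \<tau>) has_real_derivative ut x t) (at t within {r<..<t})"
    using DERIV_subset[OF u_t[of t x], of "{r<..<t}"] t x r(2) unfolding ut_def active_times_def
    by (fastforce intro: less_imp_le)
  then have "((\<lambda>\<tau>. (u x \<tau> - u x t) / (\<tau> - t)) \<longlongrightarrow> ut x t) (at t within {r<..<t})"
    by (simp add: has_field_derivative_iff)
  moreover have "at t within {r<..<t} = at_left t"
    using r(1) by (intro at_within_nhd[of t "{r<..}"]) auto
  ultimately have "((\<lambda>\<tau>. (u x \<tau> - u x t) / (\<tau> - t)) \<longlongrightarrow> ut x t) (at_left t)" by simp
  moreover have "\<forall>\<^sub>F \<tau> in at_left t. (u x \<tau> - u x t) / (\<tau> - t) = diff_quotient t \<tau> x"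
    using below eventually_at_left_real[OF t]
  proof eventually_elim
    case (elim \<tau>)
    have "(a - b) / (\<tau> - t) = (b - a) / (t - \<tau>)" for a b using elim by (simp add: field_simps)
    then show ?case using elim by (simp add: diff_quotient_def u_cut_def)
  qed
  ultimately show ?thesis by (rule Lim_transform_eventually)
qed

text \<open>If x already lay in the domain at time \<tau>, monotonicity of s keeps it there up to t,
  and the bound on u_t applies. Otherwise the earlier value is the extension 0; since u vanishes at
  the front, the later value is at most B (s(t) - s(\<tau>)), and differentiability of s bounds this
  by a multiple of t - \<tau>.\<close>

lemma diff_quotient_bounded:
  assumes t: "0 < t"
  obtains B where "\<forall>\<^sub>F \<tau> in at_left t. \<forall>x\<in>{0..s t}. \<bar>diff_quotient t \<tau> x\<bar> \<le> B"
proof -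
  \<comment> \<open>The time interval is kept away from 0, where u_t need not be bounded.\<close>
  obtain A where A: "0 < A" "\<And>x \<tau>. t / 2 \<le> \<tau> \<Longrightarrow> \<tau> \<le> t \<Longrightarrow> x \<in> {0..s \<tau>} \<Longrightarrow> \<bar>ut x \<tau>\<bar> \<le> A"
    by (rule strip_bounded[of "t / 2" t ut])
      (use t in \<open>auto intro: continuous_on_subset[OF ut_cont] simp: space_time_def\<close>)
  obtain B where B: "0 < B" "\<And>x \<tau>. 0 < \<tau> \<Longrightarrow> \<tau> \<le> t \<Longrightarrow> x \<in> {0..s \<tau>} \<Longrightarrow> \<bar>ux x \<tau>\<bar> \<le> B"
    by (rule ux_bounded[of t]) blast
  obtain d where d: "(s has_real_derivative d) (at t)" using s_diff[OF t] by blast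
  then have "(s has_real_derivative d) (at_left t)" by (rule has_field_derivative_at_within)
  then have "((\<lambda>\<tau>. (s \<tau> - s t) / (\<tau> - t)) \<longlongrightarrow> d) (at_left t)"
    by (simp add: has_field_derivative_iff)
  then have "\<forall>\<^sub>F \<tau> in at_left t. (s \<tau> - s t) / (\<tau> - t) < d + 1"
    by (rule order_tendstoD) simp
  moreover have "\<forall>\<^sub>F \<tau> in at_left t. \<tau> \<in> {t / 2<..<t}" using t by (intro eventually_at_left_real) simp
  ultimately have "\<forall>\<^sub>F \<tau> in at_left t. \<forall>x\<in>{0..s t}. \<bar>diff_quotient t \<tau> x\<bar> \<le> A + B * \<bar>d + 1\<bar>"
  proof eventually_elim
    case (elim \<tau>)
    have \<tau>: "0 < \<tau>" "\<tau> < t" "t / 2 < \<tau>" using elim t by auto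
    have AB: "0 \<le> A" "0 \<le> B * \<bar>d + 1\<bar>" using A B by auto
    show ?case
    proof
      fix x assume x: "x \<in> {0..s t}"
      have "\<bar>u x t - u_cut x \<tau>\<bar> \<le> (A + B * \<bar>d + 1\<bar>) * (t - \<tau>)"
      proof (cases "x \<le> s \<tau>")
        case True
        have "\<bar>u x t - u x \<tau>\<bar> \<le> A * \<bar>t - \<tau>\<bar>"
        proof (rule field_differentiable_bound[of "{\<tau>..t}" "\<lambda>\<tau>. u x \<tau>" "\<lambda>\<tau>. ut x \<tau>", unfolded real_norm_def])
          fix r assume r: "r \<in> {\<tau>..t}"
          then have xr: "x \<in> {0..s r}" using x True s_mono[of \<tau> r] \<tau> by auto
          then show "\<bar>ut x r\<bar> \<le> A" using A(2)[of r x] r \<tau> by auto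
          have "{\<tau>..t} \<subseteq> active_times s x" unfolding active_times_def
            using True s_mono[of \<tau>] \<tau> by force
          then show "((\<lambda>\<tau>. u x \<tau>) has_real_derivative ut x r) (at r within {\<tau>..t})"
            using u_t[of r x] xr r \<tau> unfolding ut_def by (auto intro: DERIV_subset)
        qed (use \<tau> in auto)
        also have "\<dots> \<le> (A + B * \<bar>d + 1\<bar>) * (t - \<tau>)"
          using AB \<tau> by (auto intro!: mult_right_mono)
        finally show ?thesis using True by (simp add: u_cut_def)
      next
        case False
        have "\<bar>u x t - u (s t) t\<bar> \<le> B * \<bar>x - s t\<bar>"
        proof (rule field_differentiable_bound[of "{0..s t}" "\<lambda>x. u x t" "\<lambda>x. ux x t", unfolded real_norm_def])
          fix y assume y: "y \<in> {0..s t}"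
          then show "\<bar>ux y t\<bar> \<le> B" using B(2)[of t y] t by auto
          show "((\<lambda>x. u x t) has_real_derivative ux y t) (at y within {0..s t})" by (rule u_x[OF t y])
        qed (use x in auto)
        also have "\<dots> = B * (s t - x)" using x by simp
        also have "\<dots> \<le> B * (s t - s \<tau>)" using False B by (intro mult_left_mono) auto
        also have "\<dots> \<le> B * (\<bar>d + 1\<bar> * (t - \<tau>))"
        proof (rule mult_left_mono)
          have "s t - s \<tau> = (s \<tau> - s t) / (\<tau> - t) * (t - \<tau>)" using \<tau> by (simp add: field_simps)
          also have "\<dots> \<le> \<bar>d + 1\<bar> * (t - \<tau>)" using elim \<tau> by (intro mult_right_mono) auto
          finally show "s t - s \<tau> \<le> \<bar>d + 1\<bar> * (t - \<tau>)" .
        qed (use B in simp)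
        also have "\<dots> \<le> (A + B * \<bar>d + 1\<bar>) * (t - \<tau>)" using A \<tau> by (simp add: algebra_simps)
        finally show ?thesis using False u_s[OF t] by (simp add: u_cut_def)
      qed
      then show "\<bar>diff_quotient t \<tau> x\<bar> \<le> A + B * \<bar>d + 1\<bar>"
        using \<tau> by (simp add: diff_quotient_def abs_divide divide_le_eq)
    qed
  qed
  then show ?thesis by (rule that)
qed

lemma diff_quotient_cont:
  assumes "0 < \<tau>" "\<tau> < t"
  shows "continuous_on {0..s t} (diff_quotient t \<tau>)"
  unfolding diff_quotient_def[abs_def] using assms
  by (intro continuous_intros u_cut_cont u_profile_cont) auto

lemma diff_quotient_L1_tendsto:
  assumes t: "0 < t"
  shows "((\<lambda>\<tau>. integral {0..s t} (\<lambda>x. \<bar>diff_quotient t \<tau> x - ut x t\<bar>)) \<longlongrightarrow> 0) (at_left t)"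
proof -
  obtain B where B: "\<forall>\<^sub>F \<tau> in at_left t. \<forall>x\<in>{0..s t}. \<bar>diff_quotient t \<tau> x\<bar> \<le> B"
    by (rule diff_quotient_bounded[OF t])
  obtain A where A: "\<And>x \<tau>. t \<le> \<tau> \<Longrightarrow> \<tau> \<le> t \<Longrightarrow> x \<in> {0..s \<tau>} \<Longrightarrow> \<bar>ut x \<tau>\<bar> \<le> A"
    by (rule strip_bounded[of t t ut])
      (use t in \<open>auto intro: continuous_on_subset[OF ut_cont] simp: space_time_def\<close>)
  have "((\<lambda>\<tau>. integral {0..s t} (\<lambda>x. \<bar>diff_quotient t \<tau> x - ut x t\<bar>)) \<longlongrightarrow> integral {0..s t} (\<lambda>x. 0)) (at_left t)"
  proof (rule bounded_convergence(2)[where N = "{s t}" and B = "B + A"])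
    show "\<forall>\<^sub>F \<tau> in at_left t. (\<lambda>x. \<bar>diff_quotient t \<tau> x - ut x t\<bar>) integrable_on {0..s t} \<and>
        (\<forall>x\<in>{0..s t} - {s t}. \<bar>\<bar>diff_quotient t \<tau> x - ut x t\<bar>\<bar> \<le> B + A)"
      using B eventually_at_left_real[OF t]
    proof eventually_elim
      case (elim \<tau>)
      have "(\<lambda>x. \<bar>diff_quotient t \<tau> x - ut x t\<bar>) integrable_on {0..s t}"
        using elim t by (intro integrable_continuous_real continuous_intros diff_quotient_cont ut_profile_cont) auto
      moreover have "\<bar>\<bar>diff_quotient t \<tau> x - ut x t\<bar>\<bar> \<le> B + A" if "x \<in> {0..s t}" for x
        using elim(1) that A[of t x] abs_triangle_ineq4[of "diff_quotient t \<tau> x" "ut x t"] by fastforce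
      ultimately show ?case by blast
    qed
    show "((\<lambda>\<tau>. \<bar>diff_quotient t \<tau> x - ut x t\<bar>) \<longlongrightarrow> 0) (at_left t)" if "x \<in> {0..s t} - {s t}" for x
      using tendsto_rabs[OF tendsto_diff[OF diff_quotient_tendsto[OF t, of x] tendsto_const[of "ut x t"]]] that by auto
  qed (auto simp: trivial_limit_at_left_real)
  then show ?thesis by simp
qed

text \<open>Transforming the zero extension \<open>u_cut\<close> over {0..s t} gives the zero
  extension of the earlier w. Hence the difference of the two states is t - \<tau> times the
  transform of the difference quotient, with no contribution of the moving limit. In the pairing of
  \<open>energy_difference\<close> the quotient is replaced by \<open>ut\<close>, with an error
  controlled by its L1 distance, and \<open>energy_dissipation\<close> evaluates the rest.\<close>

lemma energy_Dini:
  assumes t: "0 < t" and e: "0 < e"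
  shows "\<forall>\<^sub>F \<tau> in at_left t. energy t - energy \<tau> \<le> (t - \<tau>) * (- (2 * lam) * energy t + e)"
proof -
  define c where "c = lam / \<alpha>"
  define S where "S = s t"
  let ?v = "\<lambda>x. u x t" and ?v1 = "\<lambda>x. ux x t" and ?v2 = "\<lambda>x. uxx x t"
  let ?w = "bstep c S ?v" and ?g = "bstep_x c S ?v ?v1" and ?h = "bstep_xx c S ?v ?v1 ?v2"
  have S: "0 < S" using s_pos t by (simp add: S_def)
  have v: "continuous_on {0..S} ?v" unfolding S_def using t by (simp add: u_profile_cont)
  have h: "continuous_on {0..S} ?h"
    using t by (intro continuous_on_bstep_xx v) (simp_all add: S_def ux_profile_cont uxx_profile_cont)
  have wg: "(?w has_real_derivative ?g x) (at x within {0..S})" if "x \<in> {0..S}" for x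
    using u_x[OF t] that by (intro DERIV_bstep v that) (simp add: S_def)
  have gh: "(?g has_real_derivative ?h x) (at x within {0..S})" if "x \<in> {0..S}" for x
    using u_x[OF t] ux_x[OF t] that by (intro DERIV_bstep_x v that) (simp_all add: S_def)
  have bc: "?w S = 0" "?g 0 = 0" using u_s[OF t] ux_0[OF t] by (simp_all add: S_def bstep_x_0)
  have En: "energy t = integral {0..S} (\<lambda>x. (?g x)\<^sup>2)" by (simp add: energy_def wx_def S_def c_def)
  have eq: "bstep c S (\<lambda>x. ut x t) x = \<alpha> * ?h x - lam * ?w x" if "x \<in> {0..S}" for x
    unfolding ut_def using bstep_equation[OF \<alpha> lam c_def, of S ?v ?v1 ?v2 x] u_x[OF t] ux_x[OF t]
      uxx_profile_cont[OF t] u_s[OF t] that by (simp add: S_def c_def)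
  have "lam * energy t \<le> integral {0..S} (\<lambda>x. ?h x * (\<alpha> * ?h x - lam * ?w x))"
    unfolding En using S \<alpha> by (intro energy_dissipation wg gh h bc) auto
  also have "\<dots> = integral {0..S} (\<lambda>x. ?h x * bstep c S (\<lambda>x. ut x t) x)"
    by (rule integral_cong) (simp add: eq)
  finally have diss: "lam * energy t \<le> integral {0..S} (\<lambda>x. ?h x * bstep c S (\<lambda>x. ut x t) x)" .
  obtain K where K: "0 < K" and ker: "\<And>x y. x \<in> {0..S} \<Longrightarrow> y \<in> {0..S} \<Longrightarrow> \<bar>ker c x y\<bar> \<le> K \<and> \<bar>ker_x c x y\<bar> \<le> K"
    by (rule kernel_bound[of S c]) blast
  have "bounded (?h ` {0..S})" by (intro compact_imp_bounded compact_continuous_image h compact_Icc)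
  then obtain H where H: "0 < H" "\<And>x. x \<in> {0..S} \<Longrightarrow> \<bar>?h x\<bar> \<le> H" unfolding bounded_pos by auto
  define I where "I = (\<lambda>\<tau>. integral {0..S} (\<lambda>x. \<bar>diff_quotient t \<tau> x - ut x t\<bar>))"
  \<comment> \<open>The factor 2 is that of \<open>energy_difference\<close>; H (1 + K S) is the
    constant of \<open>integral_mult_bstep_le\<close>.\<close>
  have "((\<lambda>\<tau>. 2 * (H * (1 + K * S)) * I \<tau>) \<longlongrightarrow> 2 * (H * (1 + K * S)) * 0) (at_left t)"
    unfolding I_def S_def by (intro tendsto_intros diff_quotient_L1_tendsto t)
  then have "\<forall>\<^sub>F \<tau> in at_left t. 2 * (H * (1 + K * S)) * I \<tau> < e"
    using e by (intro order_tendstoD(2)) auto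
  with eventually_at_left_real[OF t] show ?thesis
  proof eventually_elim
    case (elim \<tau>)
    have \<tau>: "0 < \<tau>" "\<tau> < t" using elim by auto
    have S\<tau>: "0 < s \<tau>" "s \<tau> \<le> S" using s_pos[of \<tau>] s_mono[of \<tau> t] \<tau> by (auto simp: S_def)
    let ?q = "diff_quotient t \<tau>"
    have q: "continuous_on {0..S} ?q" unfolding S_def by (rule diff_quotient_cont[OF \<tau>])
    have ut: "continuous_on {0..S} (\<lambda>x. ut x t)" unfolding S_def by (rule ut_profile_cont[OF t])
    let ?W = "bstep c (s \<tau>) (\<lambda>x. u x \<tau>)"
    have diff: "?w x - (if x \<le> s \<tau> then ?W x else 0) = (t - \<tau>) * bstep c S ?q x" if x: "x \<in> {0..S}" for x
    proof -
      have vx: "continuous_on {x..S} ?v" using v x by (auto elim: continuous_on_subset)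
      have ux: "continuous_on {x..S} (\<lambda>y. u_cut y \<tau>)"
        using u_cut_cont[OF \<tau>(1), of S] x by (auto elim: continuous_on_subset)
      have W: "(if x \<le> s \<tau> then ?W x else 0) = u_cut x \<tau> - integral {x..S} (\<lambda>y. ker c x y * u_cut y \<tau>)"
      proof (cases "x \<le> s \<tau>")
        case True
        have "(\<lambda>y. ker c x y * u y \<tau>) integrable_on {x..s \<tau>}"
          using x \<tau> by (intro integrable_continuous_real continuous_intros continuous_on_subset[OF u_profile_cont]) auto
        from has_integral_cut[OF integrable_integral[OF this] S\<tau>(2)]
        have "integral {x..S} (\<lambda>y. if y \<le> s \<tau> then ker c x y * u y \<tau> else 0) = integral {x..s \<tau>} (\<lambda>y. ker c x y * u y \<tau>)"
          by (rule integral_unique)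
        moreover have "(\<lambda>y. if y \<le> s \<tau> then ker c x y * u y \<tau> else 0) = (\<lambda>y. ker c x y * u_cut y \<tau>)"
          by (auto simp: u_cut_def)
        ultimately show ?thesis using True by (simp add: bstep_def u_cut_def)
      next
        case False
        then have "integral {x..S} (\<lambda>y. ker c x y * u_cut y \<tau>) = integral {x..S} (\<lambda>y. 0)"
          by (intro integral_cong) (auto simp: u_cut_def)
        then show ?thesis using False by (simp add: u_cut_def)
      qed
      have "((\<lambda>y. ker c x y * u y t - ker c x y * u_cut y \<tau>) has_integral
         integral {x..S} (\<lambda>y. ker c x y * u y t) - integral {x..S} (\<lambda>y. ker c x y * u_cut y \<tau>)) {x..S}"
        by (intro has_integral_diff integrable_integral integrable_continuous_real continuous_intros vx ux)
      moreover have "(\<lambda>y. ker c x y * u y t - ker c x y * u_cut y \<tau>) = (\<lambda>y. (t - \<tau>) * (ker c x y * ?q y))"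
      proof
        fix y
        have "(t - \<tau>) * ?q y = u y t - u_cut y \<tau>" using \<tau> by (simp add: diff_quotient_def)
        then show "ker c x y * u y t - ker c x y * u_cut y \<tau> = (t - \<tau>) * (ker c x y * ?q y)"
          by (simp only: mult.left_commute[of "t - \<tau>"] right_diff_distrib)
      qed
      ultimately have "((\<lambda>y. (t - \<tau>) * (ker c x y * ?q y)) has_integral
         integral {x..S} (\<lambda>y. ker c x y * u y t) - integral {x..S} (\<lambda>y. ker c x y * u_cut y \<tau>)) {x..S}"
        by (simp only:)
      from integral_unique[OF this]
      have "(t - \<tau>) * integral {x..S} (\<lambda>y. ker c x y * ?q y)
         = integral {x..S} (\<lambda>y. ker c x y * u y t) - integral {x..S} (\<lambda>y. ker c x y * u_cut y \<tau>)"
        by (simp only: integral_mult_right)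
      moreover have "(t - \<tau>) * ?q x = u x t - u_cut x \<tau>" using \<tau> by (simp add: diff_quotient_def)
      ultimately show ?thesis unfolding W by (simp add: bstep_def right_diff_distrib)
    qed
    have "energy t - energy \<tau> \<le> - 2 * integral {0..S} (\<lambda>x. ?h x * (?w x - (if x \<le> s \<tau> then ?W x else 0)))"
      unfolding En unfolding energy_def wx_def c_def[symmetric]
    proof (rule energy_difference[OF _ S\<tau>(2)])
      show "continuous_on {0..s \<tau>} (bstep_x c (s \<tau>) (\<lambda>y. u y \<tau>) (\<lambda>y. ux y \<tau>))"
        using wx_profile_cont[OF \<tau>(1)] by (simp add: wx_def c_def)
      show "(?W has_real_derivative bstep_x c (s \<tau>) (\<lambda>y. u y \<tau>) (\<lambda>y. ux y \<tau>) x) (at x within {0..s \<tau>})"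
        if "x \<in> {0..s \<tau>}" for x
        using that \<tau> by (intro DERIV_bstep u_profile_cont u_x) auto
    qed (use S\<tau> bc u_s \<tau> wg gh h in auto)
    also have "integral {0..S} (\<lambda>x. ?h x * (?w x - (if x \<le> s \<tau> then ?W x else 0)))
        = integral {0..S} (\<lambda>x. (t - \<tau>) * (?h x * bstep c S ?q x))"
      by (rule integral_cong) (simp only: diff mult.left_commute)
    also have "\<dots> = (t - \<tau>) * integral {0..S} (\<lambda>x. ?h x * bstep c S ?q x)" by simp
    finally have 1: "energy t - energy \<tau> \<le> - 2 * ((t - \<tau>) * integral {0..S} (\<lambda>x. ?h x * bstep c S ?q x))" .
    have "\<bar>integral {0..S} (\<lambda>x. ?h x * bstep c S (\<lambda>x. ?q x - ut x t) x)\<bar> \<le> H * (1 + K * S) * I \<tau>"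
      unfolding I_def using S ker by (intro integral_mult_bstep_le h H continuous_intros q ut) auto
    moreover have "integral {0..S} (\<lambda>x. ?h x * bstep c S (\<lambda>x. ?q x - ut x t) x) =
       integral {0..S} (\<lambda>x. ?h x * bstep c S ?q x) - integral {0..S} (\<lambda>x. ?h x * bstep c S (\<lambda>x. ut x t) x)"
    proof -
      have "((\<lambda>x. ?h x * bstep c S ?q x - ?h x * bstep c S (\<lambda>x. ut x t) x) has_integral
       integral {0..S} (\<lambda>x. ?h x * bstep c S ?q x) - integral {0..S} (\<lambda>x. ?h x * bstep c S (\<lambda>x. ut x t) x)) {0..S}"
        by (intro has_integral_diff integrable_integral integrable_continuous_real continuous_on_mult h continuous_on_bstep q ut)
      moreover have "?h x * bstep c S ?q x - ?h x * bstep c S (\<lambda>x. ut x t) x = ?h x * bstep c S (\<lambda>x. ?q x - ut x t) x"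
        if x: "x \<in> {0..S}" for x
      proof -
        have "((\<lambda>y. ker c x y * ?q y - ker c x y * ut y t) has_integral
          integral {x..S} (\<lambda>y. ker c x y * ?q y) - integral {x..S} (\<lambda>y. ker c x y * ut y t)) {x..S}"
          using x by (intro has_integral_diff integrable_integral integrable_continuous_real continuous_intros
              continuous_on_subset[OF q] continuous_on_subset[OF ut]) auto
        then have "integral {x..S} (\<lambda>y. ker c x y * (?q y - ut y t)) =
          integral {x..S} (\<lambda>y. ker c x y * ?q y) - integral {x..S} (\<lambda>y. ker c x y * ut y t)"
          by (subst integral_unique[symmetric]) (auto simp: right_diff_distrib)
        then show ?thesis unfolding right_diff_distrib[symmetric] by (simp add: bstep_def)
      qed
      ultimately show ?thesis
        by (subst (asm) has_integral_cong) (auto intro: integral_unique)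
    qed
    ultimately have "lam * energy t - H * (1 + K * S) * I \<tau> \<le> integral {0..S} (\<lambda>x. ?h x * bstep c S ?q x)"
      using diss by linarith
    then have "- 2 * integral {0..S} (\<lambda>x. ?h x * bstep c S ?q x) \<le> - (2 * lam) * energy t + e"
      using elim by simp
    then have "(t - \<tau>) * (- 2 * integral {0..S} (\<lambda>x. ?h x * bstep c S ?q x)) \<le> (t - \<tau>) * (- (2 * lam) * energy t + e)"
      using \<tau> by (intro mult_left_mono) auto
    with 1 show ?case by (simp add: mult.left_commute)
  qed
qed

theorem energy_decay: "0 \<le> t \<Longrightarrow> energy t \<le> energy 0 * exp (- (2 * lam) * t)"
  using lam by (intro Dini_decay energy_cont energy_Dini) auto

end

section \<open>The maximum principle and the advance of the front\<close>

lemma has_real_derivative_vector_derivative: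
  fixes f :: "real \<Rightarrow> real"
  shows "f differentiable (at x within A) \<Longrightarrow>
    (f has_real_derivative vector_derivative f (at x within A)) (at x within A)"
  unfolding has_real_derivative_iff_has_vector_derivative by (simp add: vector_derivative_works)

lemma classical_profileD:
  assumes "classical_profile s u"
  shows "continuous_on (space_time s) (\<lambda>(x, t). u x t)"
    and "\<And>x t. 0 < t \<Longrightarrow> x \<in> {0..s t} \<Longrightarrow>
       ((\<lambda>y. u y t) has_real_derivative x_deriv s u x t) (at x within {0..s t})"
    and "\<And>x t. 0 < t \<Longrightarrow> x \<in> {0..s t} \<Longrightarrow>
       ((\<lambda>y. x_deriv s u y t) has_real_derivative x_deriv s (x_deriv s u) x t) (at x within {0..s t})"
    and "continuous_on (space_time s \<inter> {(x, t). 0 < t}) (\<lambda>(x, t). x_deriv s (x_deriv s u) x t)"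
  using assms unfolding classical_profile_def x_deriv_def
  by (auto intro!: has_real_derivative_vector_derivative)

text \<open>A negative slope at x already makes f smaller just to the right. If the slope is 0, it
  becomes negative to the right because d < 0, and the mean value theorem concludes. Moving only to
  the right includes the end point x = 0.\<close>

lemma not_local_min_second_derivative:
  fixes f f' :: "real \<Rightarrow> real"
  assumes x: "0 \<le> x" "x < S"
    and f: "\<And>y. y \<in> {0..S} \<Longrightarrow> (f has_real_derivative f' y) (at y within {0..S})"
    and f'': "(f' has_real_derivative d) (at x within {0..S})" "d < 0" and "f' x \<le> 0"
  obtains y where "y \<in> {0..S}" "f y < f x"
proof (cases "f' x < 0")
  case True
  from has_real_derivative_neg_dec_right[OF f this] x obtain e where
    e: "0 < e" "\<And>h. 0 < h \<Longrightarrow> x + h \<in> {0..S} \<Longrightarrow> h < e \<Longrightarrow> f (x + h) < f x" by auto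
  define h where "h = min (e / 2) (S - x)"
  show ?thesis using e x by (intro that[of "x + h"] e(2)) (auto simp: h_def min_def)
next
  case False
  from has_real_derivative_neg_dec_right[OF f''] obtain e where
    e: "0 < e" "\<And>h. 0 < h \<Longrightarrow> x + h \<in> {0..S} \<Longrightarrow> h < e \<Longrightarrow> f' (x + h) < f' x" by auto
  define h where "h = min (e / 2) (S - x)"
  have h: "0 < h" "h < e" "x + h \<le> S" using e x by (auto simp: h_def min_def)
  have "\<exists>z\<in>{x<..<x + h}. f (x + h) - f x = (*) (f' z) (x + h - x)"
    using h(1) mvt_simple[of x "x + h" f "\<lambda>z. (*) (f' z)"] DERIV_subset[OF f, of _ "{x..x + h}"] x h
    by (auto simp: has_field_derivative_def)
  then obtain z where z: "x < z" "z < x + h" "f (x + h) - f x = f' z * h" by auto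
  have "f' z < 0" using e(2)[of "z - x"] z h x False \<open>f' x \<le> 0\<close> by auto
  then have "f' z * h < 0" using h(1) by (rule mult_neg_pos)
  with z(3) have "f (x + h) < f x" by linarith
  then show ?thesis using x h by (intro that[of "x + h"]) auto
qed

text \<open>If the claim failed, T - Tm + \<epsilon> t would have a negative minimum over the
  compact strip. The data exclude the initial time and the front. Elsewhere minimality in earlier
  times gives T_xx < 0, and T_x \<le> 0 holds, at x = 0 because of the positive heat flux; both
  together contradict minimality in space.\<close>

lemma stefan_temperature_ge:
  assumes plant: "stefan_plant \<alpha> \<beta> k Tm qc T0 s0 T s" and pos: "0 < \<alpha>" "0 < k"
    and T0: "\<And>x. x \<in> {0..s0} \<Longrightarrow> Tm \<le> T0 x" and qc: "\<And>t. 0 < t \<Longrightarrow> 0 < qc t"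
    and "0 \<le> t" "x \<in> {0..s t}"
  shows "Tm \<le> T x t"
proof (rule ccontr)
  assume neg: "\<not> Tm \<le> T x t"
  have s: "continuous_on {0..} s" "\<And>t. 0 \<le> t \<Longrightarrow> 0 < s t" and cp: "classical_profile s T"
    and T_t: "\<And>x t. 0 < t \<Longrightarrow> x \<in> {0..s t} \<Longrightarrow>
        ((\<lambda>\<tau>. T x \<tau>) has_real_derivative \<alpha> * x_deriv s (x_deriv s T) x t) (at t within active_times s x)"
    and flux: "\<And>t. 0 < t \<Longrightarrow> - k * x_deriv s T 0 t = qc t"
    and bdry: "\<And>t. 0 < t \<Longrightarrow> T (s t) t = Tm"
    and init: "\<And>x. x \<in> {0..s0} \<Longrightarrow> T x 0 = T0 x" "s 0 = s0"
    using plant unfolding stefan_plant_def by auto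
  note T = classical_profileD[OF cp]
  have "0 < t" using neg init T0 assms(6,7) by (cases "t = 0") auto
  \<comment> \<open>With this choice the perturbed function at (x, t) is half of T - Tm there, hence
    still negative.\<close>
  define \<epsilon> where "\<epsilon> = (Tm - T x t) / (2 * t)"
  have \<epsilon>: "0 < \<epsilon>" using neg \<open>0 < t\<close> by (simp add: \<epsilon>_def)
  define v where "v = (\<lambda>(x, \<tau>). T x \<tau> - Tm + \<epsilon> * \<tau>)"
  let ?A = "{(x, \<tau>). 0 \<le> \<tau> \<and> \<tau> \<le> t \<and> 0 \<le> x \<and> x \<le> s \<tau>}"
  have "?A \<subseteq> space_time s" by (auto simp: space_time_def)
  then have "continuous_on ?A (\<lambda>z. T (fst z) (snd z))"
    using T(1) unfolding split_beta by (rule continuous_on_subset[rotated])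
  then have cv: "continuous_on ?A v"
    unfolding v_def split_beta by (intro continuous_intros)
  have xt: "(x, t) \<in> ?A" using assms(6,7) by auto
  then have "?A \<noteq> {}" by blast
  from continuous_attains_inf[OF compact_strip[OF s order_refl] this cv]
  obtain z where z: "z \<in> ?A" "\<And>p. p \<in> ?A \<Longrightarrow> v z \<le> v p" by blast
  obtain y r where zr: "z = (y, r)" by (cases z)
  have yr: "0 \<le> r" "r \<le> t" "0 \<le> y" "y \<le> s r" using z(1) zr by auto
  have "v (x, t) = (T x t - Tm) / 2" using \<open>0 < t\<close> by (simp add: v_def \<epsilon>_def field_simps)
  then have "v (x, t) < 0" using neg by simp
  then have vz: "T y r - Tm + \<epsilon> * r < 0" using z(2)[OF xt] by (simp add: zr v_def)
  have "0 < r" using vz T0[of y] init yr by (cases "r = 0") auto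
  have "y < s r"
    using vz bdry[OF \<open>0 < r\<close>] yr mult_pos_pos[OF \<epsilon> \<open>0 < r\<close>] by (cases "y = s r") auto
  have min_x: "T y r \<le> T y' r" if "y' \<in> {0..s r}" for y'
    using z(2)[of "(y', r)"] that yr by (simp add: zr v_def)
  have yI: "y \<in> {0..s r}" using yr by auto
  let ?D = "x_deriv s T y r" and ?D2 = "x_deriv s (x_deriv s T) y r"
  have "?D \<le> 0"
  proof (cases "y = 0")
    case True
    then have "k * ?D < 0" using flux[OF \<open>0 < r\<close>] qc[OF \<open>0 < r\<close>] by simp
    then show ?thesis using pos by (simp add: mult_less_0_iff)
  next
    case False
    show ?thesis
    proof (rule ccontr)
      assume "\<not> ?D \<le> 0"
      then obtain e where e: "0 < e" "\<And>h. 0 < h \<Longrightarrow> y - h \<in> {0..s r} \<Longrightarrow> h < e \<Longrightarrow> T (y - h) r < T y r"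
        using has_real_derivative_pos_inc_left[OF T(2)[OF \<open>0 < r\<close> yI]] by auto
      define h where "h = min (e / 2) y"
      have "0 < h" "h < e" "y - h \<in> {0..s r}" using e yr False by (auto simp: h_def min_def)
      with e(2)[of h] min_x[of "y - h"] show False by auto
    qed
  qed
  moreover have "?D2 < 0"
  proof (rule ccontr)
    assume "\<not> ?D2 < 0"
    then have "0 < \<alpha> * ?D2 + \<epsilon>" using pos \<epsilon> by (simp add: add_nonneg_pos)
    have "((\<lambda>\<tau>. T y \<tau> - Tm + \<epsilon> * \<tau>) has_real_derivative \<alpha> * ?D2 + \<epsilon>) (at r within active_times s y)"
      using T_t[OF \<open>0 < r\<close> yI] by (auto intro!: derivative_eq_intros)
    from has_real_derivative_pos_inc_left[OF this \<open>0 < \<alpha> * ?D2 + \<epsilon>\<close>] obtain e where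
      e: "0 < e" "\<And>h. 0 < h \<Longrightarrow> r - h \<in> active_times s y \<Longrightarrow> h < e \<Longrightarrow>
         T y (r - h) - Tm + \<epsilon> * (r - h) < T y r - Tm + \<epsilon> * r" by auto
    \<comment> \<open>Monotonicity of the front rests on this lemma, so it is continuity of s that
      keeps y inside the domain at slightly earlier times.\<close>
    have "continuous (at r within {0..}) s" using s(1) \<open>0 < r\<close> by (simp add: continuous_on_eq_continuous_within)
    then have "(s \<longlongrightarrow> s r) (at r within {0..})" by (simp add: continuous_within)
    then have "\<forall>\<^sub>F \<tau> in at r within {0..}. y < s \<tau>" using \<open>y < s r\<close> by (rule order_tendstoD)
    then obtain d where d: "0 < d" "\<And>\<tau>. 0 \<le> \<tau> \<Longrightarrow> \<tau> \<noteq> r \<Longrightarrow> \<bar>\<tau> - r\<bar> < d \<Longrightarrow> y < s \<tau>"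
      unfolding eventually_at by (auto simp: dist_real_def)
    define h where "h = min (min (e / 2) (d / 2)) r"
    have h: "0 < h" "h < e" "h < d" "h \<le> r" using e d \<open>0 < r\<close> by (auto simp: h_def min_def)
    have "y < s (r - h)" using h by (intro d) auto
    then have "v (y, r) \<le> v (y, r - h)" using z(2)[of "(y, r - h)"] h yr by (auto simp: zr)
    moreover have "r - h \<in> active_times s y" using \<open>y < s (r - h)\<close> h by (simp add: active_times_def)
    ultimately show False using e(2)[of h] h by (simp add: v_def)
  qed
  ultimately obtain y' where "y' \<in> {0..s r}" "T y' r < T y r"
    using not_local_min_second_derivative[OF yr(3) \<open>y < s r\<close> T(2)[OF \<open>0 < r\<close>] T(3)[OF \<open>0 < r\<close> yI]] by metis
  with min_x show False by force
qed

text \<open>The temperature is at least Tm and equals Tm at the front, so its slope there cannot be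
  positive; the front equation turns this into s'(t) \<ge> 0.\<close>

lemma stefan_front_mono:
  assumes plant: "stefan_plant \<alpha> \<beta> k Tm qc T0 s0 T s" and pos: "0 < \<alpha>" "0 < \<beta>" "0 < k"
    and T0: "\<And>x. x \<in> {0..s0} \<Longrightarrow> Tm \<le> T0 x" and qc: "\<And>t. 0 < t \<Longrightarrow> 0 < qc t"
    and "0 \<le> a" "a \<le> b"
  shows "s a \<le> s b"
proof (rule DERIV_nonneg_imp_increasing_open[OF \<open>a \<le> b\<close>])
  show "continuous_on {a..b} s"
    using plant \<open>0 \<le> a\<close> unfolding stefan_plant_def by (auto elim: continuous_on_subset)
  fix t assume "a < t" "t < b"
  then have t: "0 < t" using \<open>0 \<le> a\<close> by simp
  have st: "0 < s t" and cp: "classical_profile s T" and Ts: "T (s t) t = Tm"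
    and D: "(s has_real_derivative - \<beta> * x_deriv s T (s t) t) (at t)"
    using plant t unfolding stefan_plant_def by auto
  have "x_deriv s T (s t) t \<le> 0"
  proof (rule ccontr)
    assume "\<not> x_deriv s T (s t) t \<le> 0"
    then obtain e where e: "0 < e" "\<And>h. 0 < h \<Longrightarrow> s t - h \<in> {0..s t} \<Longrightarrow> h < e \<Longrightarrow> T (s t - h) t < T (s t) t"
      using has_real_derivative_pos_inc_left[OF classical_profileD(2)[OF cp t, of "s t"]] st by auto
    define h where "h = min (e / 2) (s t)"
    have h: "0 < h" "h < e" "s t - h \<in> {0..s t}" using e st by (auto simp: h_def min_def)
    have "Tm \<le> T (s t - h) t"
      using stefan_temperature_ge[OF plant pos(1,3) T0 qc] t h(3) by auto
    with e(2)[OF h(1,3,2)] Ts show False by simp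
  qed
  then have "0 \<le> - \<beta> * x_deriv s T (s t) t" using pos by (simp add: mult_nonneg_nonpos)
  with D show "\<exists>y. (s has_real_derivative y) (at t) \<and> 0 \<le> y" by blast
qed

section \<open>Exponential stability of the observer error\<close>

theorem theorem3:
  fixes \<alpha> \<beta> k Tm lam sr :: real
  assumes "\<alpha> > 0" and "\<beta> > 0" and "k > 0" and "lam > 0"
  shows "\<exists>D>0. \<exists>b>0. \<forall>(qc :: real \<Rightarrow> real) T0 s0 T s Y Th0 Th.
    stefan_plant \<alpha> \<beta> k Tm qc T0 s0 T s \<longrightarrow>
    (\<exists>H. \<forall>x\<in>{0..s0}. 0 \<le> T0 x - Tm \<and> T0 x - Tm \<le> H * (s0 - x)) \<longrightarrow>
    (\<forall>t\<ge>0. Y t = s t) \<longrightarrow>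
    stefan_observer \<alpha> \<beta> k Tm lam qc Y s Th0 Th \<longrightarrow>
    (\<forall>t>0. qc t > 0 \<and> s t < sr) \<longrightarrow>
    (\<forall>t\<ge>0. H1_norm_sq s (\<lambda>x t. T x t - Th x t) t
             \<le> D * H1_norm_sq s (\<lambda>x t. T x t - Th x t) 0 * exp (- b * t))"
proof -
  \<comment> \<open>A positive bound for the front whatever the sign of the setpoint, chosen before
    any solution is given.\<close>
  define L where "L = \<bar>sr\<bar> + 1"
  have L: "0 < L" by (simp add: L_def)
  obtain C\<^sub>1 where C1: "0 < C\<^sub>1"
    and upper: "\<And>S v v'. 0 < S \<Longrightarrow> S \<le> L \<Longrightarrow> v S = 0 \<Longrightarrow> continuous_on {0..S} v' \<Longrightarrow>
        (\<And>x. x \<in> {0..S} \<Longrightarrow> (v has_real_derivative v' x) (at x within {0..S})) \<Longrightarrow>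
        integral {0..S} (\<lambda>x. (v x)\<^sup>2) + integral {0..S} (\<lambda>x. (v' x)\<^sup>2)
          \<le> C\<^sub>1 * integral {0..S} (\<lambda>x. (bstep_x (lam / \<alpha>) S v v' x)\<^sup>2)"
    by (rule H1_le_energy[OF L, of "lam / \<alpha>"]) blast
  obtain C\<^sub>2 where C2: "0 < C\<^sub>2"
    and lower: "\<And>S v v'. 0 < S \<Longrightarrow> S \<le> L \<Longrightarrow> continuous_on {0..S} v \<Longrightarrow>
        (\<lambda>x. (v' x)\<^sup>2) integrable_on {0..S} \<Longrightarrow>
        (\<lambda>x. (bstep_x (lam / \<alpha>) S v v' x)\<^sup>2) integrable_on {0..S} \<Longrightarrow>
        integral {0..S} (\<lambda>x. (bstep_x (lam / \<alpha>) S v v' x)\<^sup>2)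
          \<le> C\<^sub>2 * (integral {0..S} (\<lambda>x. (v x)\<^sup>2) + integral {0..S} (\<lambda>x. (v' x)\<^sup>2))"
    by (rule energy_le_H1[OF L, of "lam / \<alpha>"]) blast
  define D where "D = 1 + C\<^sub>1 * C\<^sub>2"
  have D: "0 < D" using C1 C2 by (simp add: D_def add_pos_pos)
  have main: "H1_norm_sq s (\<lambda>x t. T x t - Th x t) t
             \<le> D * H1_norm_sq s (\<lambda>x t. T x t - Th x t) 0 * exp (- (2 * lam) * t)"
    if plant: "stefan_plant \<alpha> \<beta> k Tm qc T0 s0 T s"
      and H: "\<exists>H. \<forall>x\<in>{0..s0}. 0 \<le> T0 x - Tm \<and> T0 x - Tm \<le> H * (s0 - x)"
      and Y: "\<forall>t\<ge>0. Y t = s t"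
      and obs: "stefan_observer \<alpha> \<beta> k Tm lam qc Y s Th0 Th"
      and qs: "\<forall>t>0. qc t > 0 \<and> s t < sr" and t: "0 \<le> t"
    for qc T0 s0 T s Y Th0 Th and t :: real
  proof -
    have T0: "Tm \<le> T0 x" if "x \<in> {0..s0}" for x using H that by force
    have s_cont: "continuous_on {0..} s" and s_pos: "\<And>t. 0 \<le> t \<Longrightarrow> 0 < s t"
      and cpT: "classical_profile s T"
      and T_t: "\<And>x t. 0 < t \<Longrightarrow> x \<in> {0..s t} \<Longrightarrow>
        ((\<lambda>\<tau>. T x \<tau>) has_real_derivative \<alpha> * x_deriv s (x_deriv s T) x t) (at t within active_times s x)"
      and T_flux: "\<And>t. 0 < t \<Longrightarrow> - k * x_deriv s T 0 t = qc t"
      and T_s: "\<And>t. 0 < t \<Longrightarrow> T (s t) t = Tm"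
      and s_t: "\<And>t. 0 < t \<Longrightarrow> (s has_real_derivative - \<beta> * x_deriv s T (s t) t) (at t)"
      using plant unfolding stefan_plant_def by auto
    have cpTh: "classical_profile s Th"
      and Th_t: "\<And>x t. 0 < t \<Longrightarrow> x \<in> {0..s t} \<Longrightarrow>
        ((\<lambda>\<tau>. Th x \<tau>) has_real_derivative \<alpha> * x_deriv s (x_deriv s Th) x t
           - observer_gain \<alpha> lam x (s t) * (deriv Y t / \<beta> + x_deriv s Th (s t) t)) (at t within active_times s x)"
      and Th_flux: "\<And>t. 0 < t \<Longrightarrow> - k * x_deriv s Th 0 t = qc t"
      and Th_s: "\<And>t. 0 < t \<Longrightarrow> Th (s t) t = Tm"
      using obs unfolding stefan_observer_def by auto
    note PT = classical_profileD[OF cpT] and PTh = classical_profileD[OF cpTh]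
    define u where "u = (\<lambda>x t. T x t - Th x t)"
    define ux where "ux = (\<lambda>x t. x_deriv s T x t - x_deriv s Th x t)"
    define uxx where "uxx = (\<lambda>x t. x_deriv s (x_deriv s T) x t - x_deriv s (x_deriv s Th) x t)"
    have s_mono: "s a \<le> s b" if "0 \<le> a" "a \<le> b" for a b
      using qs that by (intro stefan_front_mono[OF plant assms(1-3) T0]) auto
    \<comment> \<open>The setpoint bound is given for positive times only; comparison with the later
      time t + 1 covers t = 0.\<close>
    have s_le: "s t \<le> L" if "0 \<le> t" for t
      using s_mono[of t "t + 1"] qs that by (auto simp: L_def dest!: spec[of _ "t + 1"])
    obtain N\<^sub>1 where N1: "finite N\<^sub>1"
        "\<And>x. x \<in> {0..s 0} - N\<^sub>1 \<Longrightarrow> (\<lambda>y. T y 0) differentiable (at x within {0..s 0})"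
        "continuous_on (space_time s - N\<^sub>1 \<times> {0}) (\<lambda>(x, t). x_deriv s T x t)"
      using cpT unfolding classical_profile_def by blast
    obtain N\<^sub>2 where N2: "finite N\<^sub>2"
        "\<And>x. x \<in> {0..s 0} - N\<^sub>2 \<Longrightarrow> (\<lambda>y. Th y 0) differentiable (at x within {0..s 0})"
        "continuous_on (space_time s - N\<^sub>2 \<times> {0}) (\<lambda>(x, t). x_deriv s Th x t)"
      using cpTh unfolding classical_profile_def by blast
    obtain M\<^sub>1 \<delta>\<^sub>1 where M1: "0 < \<delta>\<^sub>1" "\<And>t x. t \<in> {0<..\<delta>\<^sub>1} \<Longrightarrow> x \<in> {0..s t} \<Longrightarrow> \<bar>x_deriv s T x t\<bar> \<le> M\<^sub>1"
      using cpT unfolding classical_profile_def by blast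
    obtain M\<^sub>2 \<delta>\<^sub>2 where M2: "0 < \<delta>\<^sub>2" "\<And>t x. t \<in> {0<..\<delta>\<^sub>2} \<Longrightarrow> x \<in> {0..s t} \<Longrightarrow> \<bar>x_deriv s Th x t\<bar> \<le> M\<^sub>2"
      using cpTh unfolding classical_profile_def by blast
    interpret error_system \<alpha> lam L s u ux uxx "N\<^sub>1 \<union> N\<^sub>2"
    proof
      show "continuous_on (space_time s) (\<lambda>(x, t). u x t)"
        using continuous_on_diff[OF PT(1) PTh(1)] by (simp add: u_def split_beta)
      show "continuous_on (space_time s \<inter> {(x, t). 0 < t}) (\<lambda>(x, t). uxx x t)"
        using continuous_on_diff[OF PT(4) PTh(4)] by (simp add: uxx_def split_beta)
      have "continuous_on (space_time s - (N\<^sub>1 \<union> N\<^sub>2) \<times> {0}) (\<lambda>(x, t). x_deriv s T x t)"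
        "continuous_on (space_time s - (N\<^sub>1 \<union> N\<^sub>2) \<times> {0}) (\<lambda>(x, t). x_deriv s Th x t)"
        by (rule continuous_on_subset[OF N1(3)] continuous_on_subset[OF N2(3)]; blast)+
      from continuous_on_diff[OF this]
      show "continuous_on (space_time s - (N\<^sub>1 \<union> N\<^sub>2) \<times> {0}) (\<lambda>(x, t). ux x t)"
        by (simp add: ux_def split_beta)
      show "\<exists>M. \<exists>\<delta>>0. \<forall>t\<in>{0<..\<delta>}. \<forall>x\<in>{0..s t}. \<bar>ux x t\<bar> \<le> M"
      proof (intro exI conjI ballI)
        show "0 < min \<delta>\<^sub>1 \<delta>\<^sub>2" using M1 M2 by simp
        fix t x assume "t \<in> {0<..min \<delta>\<^sub>1 \<delta>\<^sub>2}" "x \<in> {0..s t}"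
        then show "\<bar>ux x t\<bar> \<le> M\<^sub>1 + M\<^sub>2"
          using M1(2)[of t x] M2(2)[of t x] abs_triangle_ineq4[of "x_deriv s T x t" "x_deriv s Th x t"]
          by (simp add: ux_def)
      qed
      fix t :: real assume t: "0 < t"
      show "\<exists>d. (s has_real_derivative d) (at t)" using s_t[OF t] by blast
      show "ux 0 t = 0"
      proof -
        have "- k * x_deriv s T 0 t = - k * x_deriv s Th 0 t" by (simp only: T_flux[OF t] Th_flux[OF t])
        then show ?thesis using assms by (simp add: ux_def)
      qed
      show "u (s t) t = 0" using T_s[OF t] Th_s[OF t] by (simp add: u_def)
      fix x assume x: "x \<in> {0..s t}"
      show "((\<lambda>y. u y t) has_real_derivative ux x t) (at x within {0..s t})"
        unfolding u_def ux_def by (rule DERIV_diff[OF PT(2)[OF t x] PTh(2)[OF t x]])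
      show "((\<lambda>y. ux y t) has_real_derivative uxx x t) (at x within {0..s t})"
        unfolding ux_def uxx_def by (rule DERIV_diff[OF PT(3)[OF t x] PTh(3)[OF t x]])
      \<comment> \<open>Y agrees with s only for nonnegative times, which is a neighbourhood of t
        since t > 0.\<close>
      have "deriv Y t = deriv s t"
      proof (rule deriv_cong_ev)
        show "\<forall>\<^sub>F \<tau> in nhds t. Y \<tau> = s \<tau>"
          by (rule eventually_nhds_in_open[of "{0<..}" t, THEN eventually_mono]) (use Y t in auto)
      qed simp
      also have "\<dots> = - \<beta> * x_deriv s T (s t) t" by (rule DERIV_imp_deriv[OF s_t[OF t]])
      finally have "deriv Y t / \<beta> + x_deriv s Th (s t) t = - ux (s t) t"
        using assms by (simp add: ux_def)
      moreover have "observer_gain \<alpha> lam x (s t) = - lam * s t / 2 * phi 1 (lam / \<alpha> / 4 * ((s t)\<^sup>2 - x\<^sup>2))"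
        using x assms by (intro observer_gain_phi) auto
      ultimately show "((\<lambda>\<tau>. u x \<tau>) has_real_derivative \<alpha> * uxx x t
          + lam * s t / 2 * phi 1 (lam / \<alpha> / 4 * ((s t)\<^sup>2 - x\<^sup>2)) * ux (s t) t) (at t within active_times s x)"
        using DERIV_diff[OF T_t[OF t x] Th_t[OF t x]] by (simp add: u_def uxx_def algebra_simps)
    qed (use assms N1(1) N2(1) s_cont s_pos s_mono s_le in auto)
    have H1: "H1_norm_sq s (\<lambda>x t. T x t - Th x t) t
        = integral {0..s t} (\<lambda>x. (u x t)\<^sup>2) + integral {0..s t} (\<lambda>x. (ux x t)\<^sup>2)" if "0 \<le> t" for t
    proof -
      \<comment> \<open>At t = 0 the profiles may lack a derivative on N1 and N2, and there the two
        slopes can take unrelated default values; finitely many points do not change the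
        integral.\<close>
      have "integral {0..s t} (\<lambda>x. (x_deriv s u x t)\<^sup>2) = integral {0..s t} (\<lambda>x. (ux x t)\<^sup>2)"
      proof (rule integral_spike[OF negligible_finite[of "N\<^sub>1 \<union> N\<^sub>2"]])
        fix x assume x: "x \<in> {0..s t} - (N\<^sub>1 \<union> N\<^sub>2)"
        have "((\<lambda>y. T y t) has_real_derivative x_deriv s T x t) (at x within {0..s t})"
          "((\<lambda>y. Th y t) has_real_derivative x_deriv s Th x t) (at x within {0..s t})"
          using PT(2)[of t x] PTh(2)[of t x] N1(2)[of x] N2(2)[of x] x that
          unfolding x_deriv_def by (cases "t = 0"; auto intro!: has_real_derivative_vector_derivative)+
        then have "((\<lambda>y. u y t) has_vector_derivative ux x t) (at x within cbox 0 (s t))"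
          unfolding u_def ux_def using DERIV_diff has_real_derivative_iff_has_vector_derivative by fastforce
        then have "x_deriv s u x t = ux x t"
          using vector_derivative_within_cbox[of 0 "s t" x "\<lambda>y. u y t"] x s_pos[OF that]
          by (simp add: x_deriv_def)
        then show "(ux x t)\<^sup>2 = (x_deriv s u x t)\<^sup>2" by simp
      qed (use N1(1) N2(1) in simp)
      then show ?thesis by (simp add: H1_norm_sq_def L2_norm_sq_def u_def)
    qed
    define h where "h = integral {0..s 0} (\<lambda>x. (u x 0)\<^sup>2) + integral {0..s 0} (\<lambda>x. (ux x 0)\<^sup>2)"
    have h: "0 \<le> h" unfolding h_def
      by (intro add_nonneg_nonneg integral_nonneg ux_square_integrable integrable_continuous_real
          continuous_intros u_profile_cont) auto
    have "energy 0 \<le> C\<^sub>2 * h"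
      unfolding energy_def wx_def h_def using wx_convergence(1)[of 0] s_pos[of 0] s_le[of 0]
      by (intro lower u_profile_cont ux_square_integrable) (auto simp: wx_def)
    have "H1_norm_sq s (\<lambda>x t. T x t - Th x t) t \<le> D * h * exp (- (2 * lam) * t)"
    proof (cases "t = 0")
      case True
      have "1 * h \<le> D * h" using h C1 C2 by (intro mult_right_mono) (auto simp: D_def)
      then show ?thesis using True H1[of 0] by (simp add: h_def)
    next
      case False
      then have t: "0 < t" using t by simp
      have "H1_norm_sq s (\<lambda>x t. T x t - Th x t) t \<le> C\<^sub>1 * energy t"
        unfolding H1[OF less_imp_le[OF t]] energy_def wx_def using t
        by (intro upper s_pos s_le u_s ux_profile_cont u_x) auto
      also have "\<dots> \<le> C\<^sub>1 * (energy 0 * exp (- (2 * lam) * t))"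
        using C1 t by (intro mult_left_mono energy_decay) auto
      also have "\<dots> \<le> C\<^sub>1 * (C\<^sub>2 * h * exp (- (2 * lam) * t))"
        using C1 \<open>energy 0 \<le> C\<^sub>2 * h\<close> by (intro mult_left_mono mult_right_mono) auto
      also have "\<dots> = C\<^sub>1 * C\<^sub>2 * (h * exp (- (2 * lam) * t))" by simp
      also have "\<dots> \<le> D * (h * exp (- (2 * lam) * t))"
        unfolding D_def using h by (intro mult_right_mono) auto
      finally show ?thesis by (simp add: mult.assoc)
    qed
    then show ?thesis using H1[of 0] by (simp add: h_def)
  qed
  show ?thesis
    using D assms main by (intro exI[of _ D] exI[of _ "2 * lam"] conjI allI impI) auto
qed

end
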